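(* Let $d\ge 1$ and let $(U_n)_{n\ge 0}$ be the infinite color urn model with colors indexed by $\mathbb{Z}^d$ associated with the bounded increment random walk with increments $\{X_j\}_{j\ge1}$. Let $\Lambda_n\in\mathcal{M}_1$ be the random probability measure on $\mathbb{R}^d$ corresponding to the random probability vector $\frac{U_n}{n+1}$, and for $n\ge2$ and Borel $A\subseteq\mathbb{R}^d$ let $$\Lambda_n^{cs}(A)=\Lambda_n\left(\sqrt{\log n}\,A\varSigma^{1/2}+\mu\log n\right).$$ Then, as $n\to\infty$, $\Lambda_n^{cs}\stackrel{p}{\longrightarrow}\Phi_d$ in $\mathcal{M}_1$.
   Context: Vectors are row vectors; $x^T$ denotes the transpose. $\{X_j\}_{j\ge1}$ are i.i.d. random vectors in $\mathbb{Z}^d$ with probability mass function $p(u)=\mathbb{P}(X_1=u)$, and there is a finite non-empty $B\subseteq\mathbb{Z}^d$ with $p(u)=0$ for $u\notin B$. Put $\mu:=\mathbb{E}[X_1]$ and $\varSigma:=\mathbb{E}[X_1^TX_1]$ (a non-centered second moment matrix), assumed positive definite; $\varSigma^{1/2}$ is its unique positive definite square root. Urn model: let $R=((p(v-u)))_{u,v\in\mathbb{Z}^d}$ and let $R_u$ be the $u$-th row of $R$. The initial configuration $U_0=(U_{0,v})_{v\in\mathbb{Z}^d}$ is a (non-random) probability vector with only finitely many non-zero entries. For $n\ge0$, the color $Z_n\in\mathbb{Z}^d$ of the $(n+1)$-th selected ball satisfies $\mathbb{P}(Z_n=v\mid U_n,\dots,U_0)=U_{n,v}/(n+1)$, $v\in\mathbb{Z}^d$,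 and $U_{n+1}=U_n+R_{Z_n}$, i.e. $U_{n+1,v}=U_{n,v}+p(v-Z_n)$. (So $\sum_v U_{n,v}=n+1$.) $\mathcal{M}_1$ is the space of probability measures on $\mathbb{R}^d$ with the topology of weak convergence; $\stackrel{p}{\longrightarrow}$ denotes convergence in probability (with respect to a metric metrizing this topology). For a set $A\subseteq\mathbb{R}^d$, a matrix $M$, a scalar $c$ and a vector $b$, $cAM+b=\{c\,aM+b: a\in A\}$. $\Phi_d$ is the standard Gaussian measure on $\mathbb{R}^d$. *)

theory Defs
  imports "HOL-Probability.Probability"
begin

definition real_vec :: "int ^ 'd \<Rightarrow> real ^ 'd" where
  "real_vec v = (\<chi> i. real_of_int (v $ i))"

section \<open>The bounded increment random walk\<close>

locale bounded_increment_walk = prob_space N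
  for N :: "'b measure" and X :: "nat \<Rightarrow> 'b \<Rightarrow> int ^ 'd::finite" +
  fixes B :: "(int ^ 'd) set"
  assumes indep: "indep_vars (\<lambda>_. count_space UNIV) X {1..}"
    and ident: "\<And>j. j \<ge> 1 \<Longrightarrow> distr N (count_space UNIV) (X j) = distr N (count_space UNIV) (X 1)"
    and B: "finite B" "B \<noteq> {}"
    and supp: "\<And>u. u \<notin> B \<Longrightarrow> prob {\<omega> \<in> space N. X 1 \<omega> = u} = 0"

definition increment_pmf :: "'b measure \<Rightarrow> (nat \<Rightarrow> 'b \<Rightarrow> int ^ 'd::finite) \<Rightarrow> int ^ 'd \<Rightarrow> real" where
  "increment_pmf N X u = measure N {\<omega> \<in> space N. X 1 \<omega> = u}"

definition increment_mean :: "'b measure \<Rightarrow> (nat \<Rightarrow> 'b \<Rightarrow> int ^ 'd::finite) \<Rightarrow> real ^ 'd" where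
  "increment_mean N X = (\<integral>\<omega>. real_vec (X 1 \<omega>) \<partial>N)"

text \<open>The product \<open>x\<^sup>T y\<close> of row vectors.\<close>

definition outer_product :: "real ^ 'd \<Rightarrow> real ^ 'd \<Rightarrow> real ^ 'd ^ 'd::finite" where
  "outer_product x y = (\<chi> i j. x $ i * y $ j)"

text \<open>Not centered: this is \<open>E[X\<^sub>1\<^sup>T X\<^sub>1]\<close>, not the covariance matrix.\<close>

definition increment_second_moment ::
    "'b measure \<Rightarrow> (nat \<Rightarrow> 'b \<Rightarrow> int ^ 'd::finite) \<Rightarrow> real ^ 'd ^ 'd" where
  "increment_second_moment N X =
     (\<integral>\<omega>. outer_product (real_vec (X 1 \<omega>)) (real_vec (X 1 \<omega>)) \<partial>N)"

definition positive_definite :: "real ^ 'd ^ 'd::finite \<Rightarrow> bool" where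
  "positive_definite A \<longleftrightarrow> transpose A = A \<and> (\<forall>x. x \<noteq> 0 \<longrightarrow> (x v* A) \<bullet> x > 0)"

text \<open>Meaningful only for positive definite arguments, where the square root exists and is unique.\<close>

definition matrix_sqrt :: "real ^ 'd ^ 'd::finite \<Rightarrow> real ^ 'd ^ 'd" where
  "matrix_sqrt A = (THE S. positive_definite S \<and> S ** S = A)"

section \<open>The urn model\<close>

definition replacement_matrix :: "(int ^ 'd \<Rightarrow> real) \<Rightarrow> int ^ 'd \<Rightarrow> int ^ 'd \<Rightarrow> real" where
  "replacement_matrix p u v = p (v - u)"

text \<open>The \<open>\<sigma>\<close>-algebra generated by \<open>U\<^sub>0, \<dots>, U\<^sub>n\<close>.\<close>

definition urn_history ::
    "'a measure \<Rightarrow> (nat \<Rightarrow> 'a \<Rightarrow> 'c \<Rightarrow> real) \<Rightarrow> nat \<Rightarrow> 'a measure" where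
  "urn_history M U n =
     sigma (space M) {{\<omega> \<in> space M. U k \<omega> v \<in> A} | k v A. k \<le> n \<and> A \<in> sets borel}"

locale infinite_color_urn = prob_space M
  for M :: "'a measure" and p :: "int ^ 'd::finite \<Rightarrow> real" and u0 :: "int ^ 'd \<Rightarrow> real"
    and Z :: "nat \<Rightarrow> 'a \<Rightarrow> int ^ 'd" and U :: "nat \<Rightarrow> 'a \<Rightarrow> int ^ 'd \<Rightarrow> real" +
  assumes init_nonneg: "\<And>v. u0 v \<ge> 0"
    and init_finite: "finite {v. u0 v \<noteq> 0}"
    and init_sum: "(\<Sum>v | u0 v \<noteq> 0. u0 v) = 1"
    and start: "\<And>\<omega>. \<omega> \<in> space M \<Longrightarrow> U 0 \<omega> = u0"
    and color: "\<And>n. Z n \<in> measurable M (count_space UNIV)"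
    and selection: "\<And>n v. AE \<omega> in M.
      real_cond_exp M (urn_history M U n) (indicator {\<omega> \<in> space M. Z n \<omega> = v}) \<omega>
        = U n \<omega> v / (real n + 1)"
    and evolution: "\<And>n \<omega> v. \<omega> \<in> space M \<Longrightarrow>
      U (Suc n) \<omega> v = U n \<omega> v + replacement_matrix p (Z n \<omega>) v"

text \<open>The measure \<open>\<Sum>\<^sub>v w v \<delta>\<^sub>v\<close> on the Borel sets of \<open>\<real>\<^sup>d\<close>.\<close>

definition lattice_measure :: "(int ^ 'd \<Rightarrow> real) \<Rightarrow> (real ^ 'd::finite) measure" where
  "lattice_measure w = distr (density (count_space UNIV) (\<lambda>v. ennreal (w v))) borel real_vec"

definition urn_measure ::
    "(nat \<Rightarrow> 'a \<Rightarrow> int ^ 'd \<Rightarrow> real) \<Rightarrow> nat \<Rightarrow> 'a \<Rightarrow> (real ^ 'd::finite) measure" where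
  "urn_measure U n \<omega> = lattice_measure (\<lambda>v. U n \<omega> v / (real n + 1))"

text \<open>For \<open>n \<ge> 2\<close> and invertible \<open>S\<close> the map \<open>a \<mapsto> \<surd>(ln n) a S + ln n m\<close> is an affine
  bijection, so images of Borel sets are Borel. The values at \<open>n < 2\<close> carry no meaning.\<close>

definition scaled_urn_measure ::
    "real ^ 'd \<Rightarrow> real ^ 'd ^ 'd \<Rightarrow> (nat \<Rightarrow> 'a \<Rightarrow> int ^ 'd \<Rightarrow> real)
      \<Rightarrow> nat \<Rightarrow> 'a \<Rightarrow> (real ^ 'd::finite) measure" where
  "scaled_urn_measure m S U n \<omega> =
     measure_of UNIV (sets borel)
       (\<lambda>A. emeasure (urn_measure U n \<omega>)
              ((\<lambda>a. sqrt (ln (real n)) *\<^sub>R (a v* S) + ln (real n) *\<^sub>R m) ` A))"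

section \<open>Weak convergence in probability\<close>

definition prob_measures :: "'c::topological_space measure set" where
  "prob_measures = {P. prob_space P \<and> sets P = sets borel}"

text \<open>The coarsest topology making \<open>P \<mapsto> \<integral> f dP\<close> continuous for every bounded continuous \<open>f\<close>.\<close>

definition weak_topology :: "'c::topological_space measure topology" where
  "weak_topology = topology_generated_by
     {{P \<in> prob_measures. (\<integral>x. f x \<partial>P) \<in> V} | f V.
        continuous_on UNIV f \<and> bounded (range f) \<and> open (V :: real set)}"

text \<open>Every metric inducing the topology is admitted, since for a constant limit the notion does
  not depend on the choice. On \<open>\<real>\<^sup>d\<close> the weak topology is metrizable, for example by the
  Levy-Prokhorov metric, so the quantification is not vacuous there.\<close>

definition converges_in_prob ::
    "'a measure \<Rightarrow> 'x topology \<Rightarrow> (nat \<Rightarrow> 'a \<Rightarrow> 'x) \<Rightarrow> 'x \<Rightarrow> bool" where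
  "converges_in_prob M T Y y \<longleftrightarrow>
     (\<forall>m. mtopology_of m = T \<longrightarrow>
       (\<forall>\<epsilon>>0. (\<lambda>n. measure M {\<omega> \<in> space M. mdist m (Y n \<omega>) y > \<epsilon>}) \<longlonglongrightarrow> 0))"

definition std_gaussian :: "(real ^ 'd::finite) measure" where
  "std_gaussian = density lborel (\<lambda>x. ennreal (\<Prod>i\<in>UNIV. std_normal_density (x $ i)))"

end

theory Submission
  imports Defs
begin

text \<open>A linear statistic of the urn is \<open>T\<^sub>n(f) = \<Sum>\<^sub>v U\<^sub>n(v) f(v)\<close>, called \<open>tally\<close> below. A draw of colour
\<open>v\<close> adds \<open>(Pf)(v) = \<Sum>\<^sub>u p(u) f(v + u)\<close> to it, and the character \<open>v \<mapsto> e\<^bsup>i\<theta>\<bullet>v\<^esup>\<close> is an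
eigenfunction of \<open>P\<close>, with eigenvalue the characteristic function \<open>\<phi>(\<theta>)\<close> of the increments. So the
first two moments of \<open>T\<^sub>n\<close> at a character satisfy one-term recursions, and the theorem follows from
convergence of the random characteristic functions \<open>T\<^sub>n / (n+1)\<close> at \<open>\<theta>\<^sub>n = \<Sigma>\<^bsup>-1/2\<^esup> t / \<surd>(ln n)\<close>.

The mean of \<open>T\<^sub>n / (n+1)\<close> is its initial value, which tends to \<open>1\<close> with
\<open>\<theta> \<rightarrow> 0\<close>, times \<open>\<Prod>\<^bsub>j<n\<^esub> (1 + (\<phi>(\<theta>) - 1)/(j+2))\<close>
(\<open>mean_average_eigenfunction\<close>). All factors, and the exponentials \<open>exp ((\<phi>(\<theta>) - 1)/(j+2))\<close>, lie in
the unit disc, so the product is \<open>exp ((\<phi>(\<theta>\<^sub>n) - 1) \<Sum>\<^bsub>j<n\<^esub> 1/(j+2))\<close> up to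
\<open>O(\<bar>\<phi>(\<theta>\<^sub>n) - 1\<bar>\<^sup>2)\<close>. The harmonic sum is \<open>ln n + O(1)\<close>, and the second order expansion of \<open>\<phi>\<close> at
\<open>0\<close> gives the centring \<open>\<mu> ln n\<close> and the limit \<open>exp (-\<bar>t\<bar>\<^sup>2/2)\<close> (\<open>mean_character_limit\<close>). The mean
measure is close to the law of a sum of a Poisson number of increments with parameter \<open>ln n\<close>, which
is why the second moment of an increment appears in place of its covariance.

The variance of \<open>T\<^sub>n / (n+1)\<close> is at most \<open>\<Sum>\<^bsub>k<n\<^esub> (1 - \<bar>m\<^sub>k(\<theta>)\<bar>\<^sup>2)/(k+2)\<^sup>2\<close>, where \<open>m\<^sub>k(\<theta>)\<close> is the
mean at time \<open>k\<close> (\<open>average_variance_le\<close>). For fixed \<open>k\<close> the mean \<open>m\<^sub>k(\<theta>)\<close> tends to \<open>1\<close> as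
\<open>\<theta> \<rightarrow> 0\<close>, so the sum vanishes along \<open>\<theta>\<^sub>n\<close> by dominated convergence
(\<open>character_deviation_limit\<close>). The random characteristic functions thus converge in mean.

The passage from characters to the weak topology is \<open>characters_and_moments_imp_convergence\<close>. Every
bounded continuous function agrees on a large cube, up to a small error, with a trigonometric
polynomial of almost the same supremum norm, and the mass outside the cube is controlled by
\<open>E[\<integral> x\<^sub>i\<^sup>2 d\<Lambda>\<^sub>n]\<close>, which is bounded because the variance of a linear form under the mean measure grows
by at most \<open>const/(n+2)\<close> in step \<open>n\<close> (\<open>second_moment_bounded\<close>). Basic weak neighbourhoods of the
limit involve finitely many test functions, which makes convergence for single test functions
sufficient, whatever metric induces the topology.\<close>

section \<open>Square roots of positive definite matrices\<close>

lemma positive_definite_inner: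
  assumes "positive_definite A"
  shows "transpose A = A" "(A *v x) \<bullet> y = x \<bullet> (A *v y)" "x \<noteq> 0 \<Longrightarrow> (A *v x) \<bullet> x > 0"
proof -
  show T: "transpose A = A" using assms by (simp add: positive_definite_def)
  have e: "x v* A = A *v x" for x using T by (metis transpose_matrix_vector)
  show "(A *v x) \<bullet> y = x \<bullet> (A *v y)" using dot_lmul_matrix[of x A y] e by simp
  show "x \<noteq> 0 \<Longrightarrow> (A *v x) \<bullet> x > 0" using assms e by (simp add: positive_definite_def)
qed

lemma positive_definiteI:
  assumes sym: "\<And>x y. (A *v x) \<bullet> y = x \<bullet> (A *v y)" and pos: "\<And>x. x \<noteq> 0 \<Longrightarrow> (A *v x) \<bullet> x > 0"
  shows "positive_definite A"
proof -
  have e: "x v* A = A *v x" for x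
  proof (rule vector_eq_rdot[THEN iffD1], rule allI)
    fix y show "(x v* A) \<bullet> y = (A *v x) \<bullet> y" by (simp add: dot_lmul_matrix sym)
  qed
  have "transpose A = A" by (subst matrix_eq) (simp add: transpose_matrix_vector e)
  then show ?thesis using pos e by (simp add: positive_definite_def)
qed

text \<open>A square root of \<open>cA\<close> is \<open>1 - Y\<close> with \<open>Y = (b + Y\<^sup>2)/2\<close> and \<open>b = 1 - cA\<close>. If \<open>c > 0\<close> is small then
\<open>b\<close> has operator norm below \<open>1\<close>, and \<open>Y \<mapsto> (b + Y\<^sup>2)/2\<close> is a contraction of a closed set of
self-adjoint operators. The fixed point has norm below \<open>1\<close>, so \<open>1 - Y\<close> is positive definite. The
argument uses the operator norm, hence bounded linear functions in place of matrices.\<close>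

lemma positive_definite_square_root_exists:
  fixes A :: "real ^ 'd ^ 'd::finite"
  assumes A: "positive_definite A"
  shows "\<exists>S. positive_definite S \<and> S ** S = A"
proof -
  note A' = positive_definite_inner[OF A]
  define a where "a = Blinfun ((*v) A)"
  have a[simp]: "blinfun_apply a x = A *v x" for x
    unfolding a_def by (simp add: bounded_linear_Blinfun_apply matrix_vector_mul_bounded_linear)
  obtain x0 :: "real ^ 'd" where x0: "norm x0 = 1" using vector_choose_size[of 1] by auto
  have "\<exists>x0\<in>sphere 0 1. \<forall>x\<in>sphere 0 1. (A *v x0) \<bullet> x0 \<le> (A *v x) \<bullet> x"
    using x0 by (intro continuous_attains_inf continuous_intros linear_continuous_on matrix_vector_mul_bounded_linear) auto
  then obtain z where z: "norm z = 1" "\<And>x. norm x = 1 \<Longrightarrow> (A *v z) \<bullet> z \<le> (A *v x) \<bullet> x" by auto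
  define l where "l = (A *v z) \<bullet> z"
  have l: "l > 0" unfolding l_def using z(1) by (intro A'(3)) auto
  have low: "l * (norm x)\<^sup>2 \<le> (A *v x) \<bullet> x" for x
  proof (cases "x = 0")
    case False
    have "l \<le> (A *v (x /\<^sub>R norm x)) \<bullet> (x /\<^sub>R norm x)" unfolding l_def using False by (intro z(2)) simp
    also have "\<dots> = (A *v x) \<bullet> x / (norm x)\<^sup>2"
      by (simp add: matrix_vector_mult_scaleR power2_eq_square field_simps)
    finally show ?thesis using False by (simp add: field_simps)
  qed simp
  define m where "m = norm a"
  have up: "norm (A *v x) \<le> m * norm x" for x using norm_blinfun[of a x] by (simp add: m_def)
  have "l \<le> m"
  proof -
    have "l \<le> norm (A *v z) * norm z" unfolding l_def by (rule norm_cauchy_schwarz)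
    also have "\<dots> \<le> m" using up[of z] z by simp
    finally show ?thesis .
  qed
  then have m: "m > 0" using l by simp
  \<comment> \<open>the choice of \<open>c\<close> that minimizes the bound \<open>1 - 2 c l + c\<^sup>2 m\<^sup>2\<close> for \<open>\<parallel>1 - cA\<parallel>\<^sup>2\<close>\<close>
  define c where "c = l / m\<^sup>2"
  have c: "c > 0" using l m by (simp add: c_def)
  define q where "q = 1 - l\<^sup>2 / m\<^sup>2"
  have "l\<^sup>2 \<le> m\<^sup>2" using \<open>l \<le> m\<close> l by (intro power_mono) auto
  then have q: "0 \<le> q" "q < 1" using l m by (auto simp: q_def)
  define r where "r = sqrt q"
  have r: "0 \<le> r" "r < 1" using q by (auto simp: r_def)
  define b where "b = id_blinfun - c *\<^sub>R a"
  have b_app: "blinfun_apply b x = x - c *\<^sub>R (A *v x)" for x by (simp add: b_def blinfun.diff_left blinfun.scaleR_left)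
  have b_norm: "norm b \<le> r"
  proof (rule norm_blinfun_bound[OF r(1)])
    fix x
    have "(norm (b x))\<^sup>2 = (norm x)\<^sup>2 - 2 * c * ((A *v x) \<bullet> x) + c\<^sup>2 * (norm (A *v x))\<^sup>2"
      unfolding b_app power2_norm_eq_inner by (simp add: algebra_simps inner_commute power2_eq_square)
    also have "\<dots> \<le> (norm x)\<^sup>2 - 2 * c * (l * (norm x)\<^sup>2) + c\<^sup>2 * (m * norm x)\<^sup>2"
      using c low up by (intro add_mono diff_mono mult_left_mono power_mono) auto
    also have "\<dots> = q * (norm x)\<^sup>2"
      using m by (simp add: c_def q_def field_simps power2_eq_square)
    also have "\<dots> = (r * norm x)\<^sup>2" using q by (simp add: r_def power_mult_distrib)
    finally show "norm (b x) \<le> r * norm x"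
      using r by (intro power2_le_imp_le[OF _ mult_nonneg_nonneg]) auto
  qed
  \<comment> \<open>self-adjointness is a closed condition, so the fixed point inherits it\<close>
  define K where "K = {y :: (real ^ 'd) \<Rightarrow>\<^sub>L (real ^ 'd). norm y \<le> r \<and> (\<forall>u v. blinfun_apply y u \<bullet> v = u \<bullet> blinfun_apply y v)}"
  define F where "F y = (1/2) *\<^sub>R (b + (y o\<^sub>L y))" for y :: "(real ^ 'd) \<Rightarrow>\<^sub>L (real ^ 'd)"
  have "closed K" unfolding K_def
    by (intro closed_Collect_conj closed_Collect_all closed_Collect_le closed_Collect_eq continuous_intros)
  note complete_eq_closed[THEN iffD2, OF this]
  moreover have "K \<noteq> {}" using r by (auto simp: K_def intro!: exI[of _ 0])
  moreover have "F ` K \<subseteq> K"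
  proof safe
    fix y assume y: "y \<in> K"
    have "norm (F y) \<le> (1/2) * (norm b + norm (y o\<^sub>L y))" unfolding F_def using norm_triangle_ineq[of b "y o\<^sub>L y"] by simp
    also have "\<dots> \<le> (1/2) * (r + r * r)"
    proof -
      have "norm (y o\<^sub>L y) \<le> norm y * norm y" by (rule norm_blinfun_compose)
      also have "\<dots> \<le> r * r" using y r by (intro mult_mono) (auto simp: K_def)
      finally show ?thesis using b_norm by simp
    qed
    also have "\<dots> \<le> r" using r mult_left_mono[of r 1 r] by simp
    finally show "F y \<in> K" using y A'(2)
      by (auto simp: K_def F_def blinfun.add_left blinfun.scaleR_left b_app inner_add_left inner_add_right inner_diff_left inner_diff_right)
  qed
  moreover have "dist (F y) (F w) \<le> r * dist y w" if "y \<in> K" "w \<in> K" for y w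
  proof -
    have "F y - F w = (1/2) *\<^sub>R ((y o\<^sub>L (y - w)) + ((y - w) o\<^sub>L w))"
      by (rule blinfun_eqI) (simp add: F_def blinfun.add_left blinfun.diff_left blinfun.diff_right blinfun.scaleR_left blinfun.scaleR_right algebra_simps)
    then have "norm (F y - F w) \<le> (1/2) * (norm (y o\<^sub>L (y - w)) + norm ((y - w) o\<^sub>L w))"
      using norm_triangle_ineq[of "y o\<^sub>L (y - w)" "(y - w) o\<^sub>L w"] by simp
    also have "\<dots> \<le> (1/2) * (r * norm (y - w) + norm (y - w) * r)"
      using that r(1) by (intro mult_left_mono add_mono order_trans[OF norm_blinfun_compose] mult_mono) (auto simp: K_def)
    finally show ?thesis by (simp add: dist_norm)
  qed
  ultimately have "\<exists>!y\<in>K. F y = y" using r by (intro Banach_fix) auto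
  then obtain y where y: "y \<in> K" "F y = y" by auto
  have yy: "y (y x) = 2 *\<^sub>R y x - b x" for x
  proof -
    have "blinfun_apply (F y) x = y x" by (simp add: y(2))
    then have "(1/2) *\<^sub>R (b x + y (y x)) = y x" by (simp add: F_def blinfun.add_left blinfun.scaleR_left)
    then have "2 *\<^sub>R ((1/2) *\<^sub>R (b x + y (y x))) = 2 *\<^sub>R y x" by simp
    then have "b x + y (y x) = 2 *\<^sub>R y x" by simp
    then show ?thesis by (simp add: algebra_simps)
  qed
  define s where "s x = (1 / sqrt c) *\<^sub>R (x - y x)" for x
  have s_lin: "linear s" unfolding s_def
    by (intro linear_compose_scale_right linear_compose_sub linear_ident bounded_linear.linear blinfun.bounded_linear_right)
  have S: "matrix s *v x = s x" for x using s_lin by (simp add: matrix_works)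
  have "positive_definite (matrix s)"
  proof (rule positive_definiteI)
    show "(matrix s *v x) \<bullet> w = x \<bullet> (matrix s *v w)" for x w
      using y(1) by (auto simp: S s_def K_def inner_diff_left inner_diff_right)
    fix x :: "real ^ 'd" assume x: "x \<noteq> 0"
    have "y x \<bullet> x \<le> norm (y x) * norm x" by (rule norm_cauchy_schwarz)
    also have "\<dots> \<le> (norm y * norm x) * norm x" by (intro mult_right_mono norm_blinfun) auto
    also have "\<dots> \<le> (r * norm x) * norm x" using y(1) by (intro mult_right_mono) (auto simp: K_def)
    also have "\<dots> < 1 * (norm x * norm x)" unfolding mult.assoc using r x by (intro mult_strict_right_mono) auto
    finally have "y x \<bullet> x < x \<bullet> x" by (simp add: dot_square_norm power2_eq_square)
    then show "(matrix s *v x) \<bullet> x > 0" using c by (simp add: S s_def inner_diff_left)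
  qed
  moreover have "matrix s ** matrix s = A"
  proof (subst matrix_eq, rule allI)
    fix x
    have "s (s x) = (1 / c) *\<^sub>R (x - 2 *\<^sub>R y x + y (y x))"
    proof -
      have "s x - y (s x) = (1 / sqrt c) *\<^sub>R (x - y x - (y x - y (y x)))"
        by (simp only: s_def blinfun.scaleR_right blinfun.diff_right scaleR_diff_right)
      then have "s (s x) = (1 / sqrt c * (1 / sqrt c)) *\<^sub>R (x - y x - (y x - y (y x)))"
        by (subst s_def) (simp only: scaleR_scaleR)
      moreover have "x - y x - (y x - y (y x)) = x - 2 *\<^sub>R y x + y (y x)" by (simp add: scaleR_2)
      moreover have "1 / sqrt c * (1 / sqrt c) = 1 / c" using c by simp
      ultimately show ?thesis by (simp only:)
    qed
    also have "\<dots> = A *v x" using c by (simp add: yy b_app)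
    finally show "(matrix s ** matrix s) *v x = A *v x" by (simp flip: matrix_vector_mul_assoc add: S)
  qed
  ultimately show ?thesis by blast
qed

text \<open>The difference \<open>D = S - T\<close> solves the Sylvester equation \<open>SD + DT = 0\<close>. Multiplication by \<open>D\<close> and
taking the trace yields two nonnegative summands, the first being \<open>\<Sum>\<^sub>i (S D e\<^sub>i) \<bullet> (D e\<^sub>i)\<close>, which
vanishes only if every column of \<open>D\<close> does.\<close>

lemma positive_definite_square_root_unique:
  fixes S T :: "real ^ 'd ^ 'd::finite"
  assumes S: "positive_definite S" and T: "positive_definite T" and eq: "S ** S = T ** T"
  shows "S = T"
proof (rule ccontr)
  assume "S \<noteq> T"
  define D where "D = S - T"
  note S' = positive_definite_inner[OF S] and T' = positive_definite_inner[OF T]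
  have D: "D *v x = S *v x - T *v x" for x by (simp add: D_def matrix_vector_mult_diff_rdistrib)
  have symD: "(D *v x) \<bullet> y = x \<bullet> (D *v y)" for x y
    by (simp add: D inner_diff_left inner_diff_right S'(2) T'(2))
  have syl: "S *v (D *v x) + D *v (T *v x) = 0" for x
  proof -
    have "S *v (S *v x) = T *v (T *v x)" using eq by (simp add: matrix_vector_mul_assoc)
    then show ?thesis by (simp add: D matrix_vector_mult_diff_distrib)
  qed
  let ?e = "\<lambda>i. axis i (1::real) :: real ^ 'd"
  have basis: "x \<bullet> y = (\<Sum>i\<in>UNIV. (x \<bullet> ?e i) * (y \<bullet> ?e i))" for x y :: "real ^ 'd"
    by (subst inner_vec_def) (simp add: inner_axis)
  \<comment> \<open>the trace of \<open>D\<^sup>T (SD + DT)\<close>; the double sum below is swapped to move \<open>T\<close> to the other side\<close>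
  have "(\<Sum>i\<in>UNIV. (S *v (D *v ?e i)) \<bullet> (D *v ?e i)) + (\<Sum>i\<in>UNIV. (T *v (D *v ?e i)) \<bullet> (D *v ?e i)) = 0"
  proof -
    have "(\<Sum>i\<in>UNIV. (T *v (D *v ?e i)) \<bullet> (D *v ?e i))
        = (\<Sum>i\<in>UNIV. \<Sum>j\<in>UNIV. ((T *v (D *v ?e i)) \<bullet> ?e j) * ((D *v ?e i) \<bullet> ?e j))"
      by (subst basis) simp
    also have "\<dots> = (\<Sum>j\<in>UNIV. \<Sum>i\<in>UNIV. ((T *v (D *v ?e i)) \<bullet> ?e j) * ((D *v ?e i) \<bullet> ?e j))"
      by (rule sum.swap)
    also have "\<dots> = (\<Sum>j\<in>UNIV. \<Sum>i\<in>UNIV. ((D *v (T *v ?e j)) \<bullet> ?e i) * ((D *v ?e j) \<bullet> ?e i))"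
    proof (intro sum.cong refl arg_cong2[where f = "(*)"])
      fix i j
      show "(T *v (D *v ?e i)) \<bullet> ?e j = (D *v (T *v ?e j)) \<bullet> ?e i"
        using T'(2)[of "D *v ?e i" "?e j"] symD[of "?e i" "T *v ?e j"] by (simp add: inner_commute)
      show "(D *v ?e i) \<bullet> ?e j = (D *v ?e j) \<bullet> ?e i"
        using symD[of "?e i" "?e j"] by (simp add: inner_commute)
    qed
    also have "\<dots> = (\<Sum>j\<in>UNIV. (D *v (T *v ?e j)) \<bullet> (D *v ?e j))"
      by (subst basis[symmetric]) simp
    finally show ?thesis by (simp add: syl flip: sum.distrib inner_add_left)
  qed
  moreover have nn: "(S *v x) \<bullet> x \<ge> 0" "(T *v x) \<bullet> x \<ge> 0" for x
    using S'(3)[of x] T'(3)[of x] by (cases "x = 0"; simp)+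
  ultimately have "(\<Sum>i\<in>UNIV. (S *v (D *v ?e i)) \<bullet> (D *v ?e i)) = 0"
    using sum_nonneg[of UNIV "\<lambda>i. (S *v (D *v ?e i)) \<bullet> (D *v ?e i)"]
      sum_nonneg[of UNIV "\<lambda>i. (T *v (D *v ?e i)) \<bullet> (D *v ?e i)"] by simp
  then have "(S *v (D *v ?e i)) \<bullet> (D *v ?e i) = 0" for i
    using nn by (subst (asm) sum_nonneg_eq_0_iff) auto
  then have "D *v ?e i = 0" for i using S'(3)[of "D *v ?e i"] by force
  then have "D = 0" by (simp add: vec_eq_iff matrix_vector_mul_component inner_axis)
  then show False using \<open>S \<noteq> T\<close> by (simp add: D_def)
qed

text \<open>Existence and uniqueness turn the definite description in the definition into an actual root.\<close>

lemma matrix_sqrt: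
  assumes "positive_definite A"
  shows "positive_definite (matrix_sqrt A)" "matrix_sqrt A ** matrix_sqrt A = A"
proof -
  have "\<exists>!S. positive_definite S \<and> S ** S = A"
    using positive_definite_square_root_exists[OF assms] positive_definite_square_root_unique by metis
  from theI'[OF this] show "positive_definite (matrix_sqrt A)" "matrix_sqrt A ** matrix_sqrt A = A"
    by (simp_all add: matrix_sqrt_def)
qed

lemma positive_definite_invertible:
  fixes S :: "real ^ 'd ^ 'd::finite"
  assumes "positive_definite S"
  shows "invertible S"
proof -
  have "x = 0" if "S *v x = 0" for x using positive_definite_inner(3)[OF assms, of x] that by force
  then show ?thesis by (simp add: invertible_left_inverse matrix_left_invertible_ker)
qed

section \<open>The standard Gaussian measure\<close>

text \<open>Lebesgue measure on \<open>\<real>\<^sup>d\<close> is the image of a product measure indexed by the standard basis; the proof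
transports Fubini for finite products along the bijection between coordinates and basis vectors.\<close>

lemma integral_lborel_vec_prod:
  fixes F :: "'d::finite \<Rightarrow> real \<Rightarrow> 'e::{real_normed_field, banach, second_countable_topology}"
  assumes F: "\<And>i. integrable lborel (F i)"
  shows "(\<integral>x. (\<Prod>i\<in>UNIV. F i (x $ i)) \<partial>(lborel :: (real ^ 'd) measure)) = (\<Prod>i\<in>UNIV. \<integral>y. F i y \<partial>lborel)"
proof -
  interpret product_sigma_finite "\<lambda>_::real ^ 'd. lborel :: real measure" ..
  have [measurable]: "F i \<in> borel_measurable borel" for i using borel_measurable_integrable[OF F] by simp
  have inj: "inj (\<lambda>i::'d. axis i (1::real))" by (rule injI) (simp add: axis_eq_axis)
  have Basis: "Basis = range (\<lambda>i::'d. axis i (1::real))" by (auto simp: Basis_vec_def)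
  have comp: "(\<Sum>b\<in>Basis. f b *\<^sub>R b) $ i = f (axis i 1)" for f :: "real ^ 'd \<Rightarrow> real" and i
  proof -
    have "(\<Sum>b\<in>Basis. f b *\<^sub>R b) $ i = (\<Sum>j\<in>UNIV. f (axis j 1) * axis j 1 $ i)"
      unfolding Basis sum.reindex[OF inj] by simp
    also have "\<dots> = (\<Sum>j\<in>UNIV. if j = i then f (axis j 1) else 0)"
      by (intro sum.cong) (auto simp: axis_def)
    finally show ?thesis by simp
  qed
  have "(\<integral>x. (\<Prod>i\<in>UNIV. F i (x $ i)) \<partial>(lborel :: (real ^ 'd) measure))
      = (\<integral>f. (\<Prod>i\<in>UNIV. F i ((\<Sum>b\<in>Basis. f b *\<^sub>R b) $ i)) \<partial>(\<Pi>\<^sub>M b\<in>(Basis :: (real ^ 'd) set). lborel))"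
    by (subst lborel_eq) (rule integral_distr; measurable)
  also have "\<dots> = (\<integral>f. (\<Prod>b\<in>Basis. F (axis_index b) (f b)) \<partial>(\<Pi>\<^sub>M b\<in>(Basis :: (real ^ 'd) set). lborel))"
    unfolding comp unfolding Basis by (subst prod.reindex[OF inj]) simp
  also have "\<dots> = (\<Prod>b\<in>(Basis :: (real ^ 'd) set). \<integral>y. F (axis_index b) y \<partial>lborel)"
    by (rule product_integral_prod) (auto simp: F)
  also have "\<dots> = (\<Prod>i\<in>UNIV. \<integral>y. F i y \<partial>lborel)"
    unfolding Basis by (subst prod.reindex[OF inj]) simp
  finally show ?thesis .
qed

lemma borel_measurable_cis [measurable]: "cis \<in> borel_measurable borel"
  by (intro borel_measurable_continuous_onI continuous_intros)

lemma cis_sum: "cis (sum f A) = (\<Prod>x\<in>A. cis (f x))"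
  by (induction A rule: infinite_finite_induct) (auto simp flip: cis_mult)

lemma std_gaussian_prob: "prob_space (std_gaussian :: (real ^ 'd::finite) measure)"
proof
  let ?g = "\<lambda>x :: real ^ 'd. \<Prod>i\<in>UNIV. std_normal_density (x $ i)"
  have int: "integrable lborel std_normal_density" by (rule integrable_normal_density) simp
  have one: "(\<integral>x. ?g x \<partial>lborel) = 1"
    by (subst integral_lborel_vec_prod) (use int in \<open>auto simp: integral_normal_density\<close>)
  then have "integrable lborel ?g" using not_integrable_integral_eq by fastforce
  then have "(\<integral>\<^sup>+x. ennreal (?g x) \<partial>lborel) = 1"
    using one by (subst nn_integral_eq_integral) (auto intro!: prod_nonneg)
  then show "emeasure (std_gaussian :: (real ^ 'd) measure) (space std_gaussian) = 1"
    by (simp add: std_gaussian_def emeasure_density)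
qed

lemma std_gaussian_prob_measures: "std_gaussian \<in> prob_measures"
  by (simp add: prob_measures_def std_gaussian_prob) (simp add: std_gaussian_def)

lemma std_gaussian_char:
  "(\<integral>x. cis (t \<bullet> x) \<partial>std_gaussian) = of_real (exp (- (t \<bullet> t) / 2))" for t :: "real ^ 'd::finite"
proof -
  have int: "integrable lborel std_normal_density" by (rule integrable_normal_density) simp
  have F: "integrable lborel (\<lambda>y. std_normal_density y *\<^sub>R cis (a * y))" for a
    by (rule Bochner_Integration.integrable_bound[OF int]) auto
  have 1: "(\<integral>y. std_normal_density y *\<^sub>R cis (a * y) \<partial>lborel) = of_real (exp (- a\<^sup>2 / 2))" for a
    using fun_cong[OF char_std_normal_distribution, of a]
    by (simp add: char_def integral_density cis_conv_exp)
  have "(\<integral>x. cis (t \<bullet> x) \<partial>std_gaussian)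
      = (\<integral>x. (\<Prod>i\<in>UNIV. std_normal_density (x $ i)) *\<^sub>R cis (t \<bullet> x) \<partial>(lborel :: (real ^ 'd) measure))"
    unfolding std_gaussian_def by (rule integral_density) (auto intro!: prod_nonneg)
  also have "\<dots> = (\<integral>x. (\<Prod>i\<in>UNIV. std_normal_density (x $ i) *\<^sub>R cis (t $ i * x $ i)) \<partial>(lborel :: (real ^ 'd) measure))"
    by (simp add: inner_vec_def cis_sum scaleR_conv_of_real prod.distrib)
  also have "\<dots> = (\<Prod>i\<in>UNIV. \<integral>y. std_normal_density y *\<^sub>R cis (t $ i * y) \<partial>lborel)"
    by (rule integral_lborel_vec_prod) (rule F)
  also have "\<dots> = (\<Prod>i\<in>UNIV. of_real (exp (- (t $ i)\<^sup>2 / 2)))" by (simp only: 1)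
  also have "\<dots> = of_real (exp (\<Sum>i\<in>UNIV. - (t $ i)\<^sup>2 / 2))" by (simp add: exp_sum)
  also have "(\<Sum>i\<in>UNIV. - (t $ i)\<^sup>2 / 2) = - (t \<bullet> t) / 2"
    by (simp add: inner_vec_def power2_eq_square sum_negf flip: sum_divide_distrib)
  finally show ?thesis .
qed

section \<open>Trigonometric polynomials\<close>

text \<open>The linear span of the characters. Convergence of characteristic functions is linear in the test
function, so it passes to this span at once.\<close>

inductive trig_poly :: "('v::real_inner \<Rightarrow> complex) \<Rightarrow> bool" where
  character: "trig_poly (\<lambda>x. cis (t \<bullet> x))"
| add: "trig_poly f \<Longrightarrow> trig_poly g \<Longrightarrow> trig_poly (\<lambda>x. f x + g x)"
| scale: "trig_poly f \<Longrightarrow> trig_poly (\<lambda>x. c * f x)"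

lemma trig_poly_const: "trig_poly (\<lambda>x. c)"
  using trig_poly.scale[OF trig_poly.character[of 0], of c] by simp

lemma trig_poly_mult:
  assumes "trig_poly f" "trig_poly g"
  shows "trig_poly (\<lambda>x. f x * g x)"
  using assms(1)
proof induction
  case (character t)
  show ?case using assms(2)
  proof induction
    case (character s)
    have "trig_poly (\<lambda>x. cis ((t + s) \<bullet> x))" by (rule trig_poly.character)
    then show ?case by (simp add: inner_add_left cis_mult)
  next
    case (add f g)
    then show ?case using trig_poly.add[OF add.IH] by (simp add: distrib_left)
  next
    case (scale f c)
    then show ?case using trig_poly.scale[OF scale.IH, of c] by (simp add: mult_ac)
  qed
next
  case (add f g)
  then show ?case using trig_poly.add[OF add.IH] by (simp add: distrib_right)
next
  case (scale f c)
  then show ?case using trig_poly.scale[OF scale.IH, of c] by (simp add: mult_ac)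
qed

lemma trig_poly_sum: "(\<And>i. i \<in> I \<Longrightarrow> trig_poly (f i)) \<Longrightarrow> trig_poly (\<lambda>x. \<Sum>i\<in>I. f i x)"
  by (induction I rule: infinite_finite_induct) (auto intro: trig_poly_const trig_poly.add)

lemma trig_poly_sin: "trig_poly (\<lambda>x. of_real (sin (t \<bullet> x)))"
proof -
  have "trig_poly (\<lambda>x. (- \<i> / 2) * cis (t \<bullet> x) + (\<i> / 2) * cis ((- t) \<bullet> x))"
    by (intro trig_poly.intros)
  moreover have "(- \<i> / 2) * cis (t \<bullet> x) + (\<i> / 2) * cis ((- t) \<bullet> x) = of_real (sin (t \<bullet> x))" for x
    by (simp add: complex_eq_iff)
  ultimately show ?thesis by simp
qed

lemma trig_poly_continuous_bounded:
  assumes "trig_poly f"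
  shows "continuous_on UNIV f" "bounded (range f)"
proof -
  show "continuous_on UNIV f" using assms by induction (auto intro!: continuous_intros)
  have "\<exists>C. \<forall>x. norm (f x) \<le> C" using assms
  proof induction
    case (character t)
    show ?case by (rule exI[of _ 1]) simp
  next
    case (add f g)
    then obtain C D where "\<forall>x. norm (f x) \<le> C" "\<forall>x. norm (g x) \<le> D" by auto
    then have "\<forall>x. norm (f x + g x) \<le> C + D" by (auto intro: norm_triangle_mono)
    then show ?case ..
  next
    case (scale f c)
    then obtain C where "\<forall>x. norm (f x) \<le> C" by auto
    then have "\<forall>x. norm (c * f x) \<le> norm c * C" by (auto simp: norm_mult mult_left_mono)
    then show ?case ..
  qed
  then show "bounded (range f)" by (auto simp: bounded_iff)
qed

text \<open>The span of the characters is an algebra that contains \<open>sin (c x\<^sub>i)\<close>.\<close>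

lemma trig_poly_polynomial_of_sines:
  fixes P :: "real ^ 'd::finite \<Rightarrow> real"
  assumes "real_polynomial_function P"
  shows "trig_poly (\<lambda>x. of_real (P (\<chi> i. sin (c * x $ i))))"
  using assms
proof induction
  case (linear f)
  have f: "f v = (\<Sum>i\<in>UNIV. f (axis i 1) * v $ i)" for v
  proof -
    have "f v = f (\<Sum>i\<in>UNIV. v $ i *\<^sub>R axis i 1)"
      using basis_expansion[of v] by (simp add: scalar_mult_eq_scaleR)
    also have "\<dots> = (\<Sum>i\<in>UNIV. f (axis i 1) * v $ i)"
      using bounded_linear.linear[OF linear] by (simp add: linear_sum linear_scale mult.commute)
    finally show ?thesis .
  qed
  have "trig_poly (\<lambda>x. \<Sum>i\<in>UNIV. of_real (f (axis i 1)) * of_real (sin ((c *\<^sub>R axis i 1) \<bullet> (x :: real ^ 'd))))"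
    by (intro trig_poly_sum trig_poly.scale trig_poly_sin)
  then show ?case by (subst f) (simp add: inner_axis')
next
  case (const c)
  show ?case by (rule trig_poly_const)
next
  case (add f g)
  then show ?case using trig_poly.add[OF add.IH] by simp
next
  case (mult f g)
  then show ?case using trig_poly_mult[OF mult.IH] by simp
qed

text \<open>Uniform approximation on the cube alone would leave the approximant uncontrolled outside. The remedy
is to fold space onto the cube: with \<open>c = \<pi>/(2K)\<close> the triangle wave \<open>arcsin (sin (c y)) / c\<close> is the
identity on \<open>[-K, K]\<close>, so \<open>x \<mapsto> f (arcsin (sin (c x\<^sub>i)) / c)\<^sub>i\<close> equals \<open>f\<close> on the cube and has no
larger supremum anywhere. It is a continuous function of the sines, which the Weierstrass theorem
approximates on \<open>[-1, 1]\<^sup>d\<close> by a polynomial, uniformly in all \<open>x\<close>.\<close>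

lemma trig_poly_approximation_on_cube:
  fixes f :: "real ^ 'd::finite \<Rightarrow> real"
  assumes f: "continuous_on UNIV f" "\<And>x. \<bar>f x\<bar> \<le> C" and "K > 0" "\<delta> > 0"
  obtains Q where "trig_poly (\<lambda>x. of_real (Q x))" "\<And>x. \<bar>Q x\<bar> \<le> C + \<delta>"
    "\<And>x. (\<And>i. \<bar>x $ i\<bar> \<le> K) \<Longrightarrow> \<bar>f x - Q x\<bar> \<le> \<delta>"
proof -
  define c where "c = pi / (2 * K)"
  have c: "c > 0" using \<open>K > 0\<close> by (simp add: c_def)
  define h where "h s = f (\<chi> i. arcsin (s $ i) / c)" for s :: "real ^ 'd"
  let ?S = "cbox (\<chi> i. -1) (\<chi> i. 1) :: (real ^ 'd) set"
  have S: "s \<in> ?S \<longleftrightarrow> (\<forall>i. -1 \<le> s $ i \<and> s $ i \<le> 1)" for s by (simp add: mem_box_cart)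
  have "continuous_on ?S (\<lambda>s. \<chi> i. arcsin (s $ i) / c)"
    using c by (intro continuous_on_vec_lambda continuous_intros) (auto simp: S)
  then have "continuous_on ?S h"
    unfolding h_def by (rule continuous_on_compose2[OF f(1)]) simp
  then obtain P where P: "real_polynomial_function P" "\<And>s. s \<in> ?S \<Longrightarrow> \<bar>h s - P s\<bar> < \<delta>"
    using Stone_Weierstrass_real_polynomial_function[OF compact_cbox _ \<open>\<delta> > 0\<close>] by blast
  define Q where "Q x = P (\<chi> i. sin (c * x $ i))" for x :: "real ^ 'd"
  have near: "\<bar>h (\<chi> i::'d. sin (c * x $ i)) - Q x\<bar> < \<delta>" for x :: "real ^ 'd"
    unfolding Q_def by (intro P(2)) (simp add: S)
  show thesis
  proof
    show "trig_poly (\<lambda>x. of_real (Q x))"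
      unfolding Q_def using P(1) by (rule trig_poly_polynomial_of_sines)
    show "\<bar>Q x\<bar> \<le> C + \<delta>" for x
      using near[of x] f(2)[of "\<chi> i. arcsin (sin (c * x $ i)) / c"] by (simp add: h_def)
    fix x :: "real ^ 'd" assume x: "\<And>i. \<bar>x $ i\<bar> \<le> K"
    have "arcsin (sin (c * x $ i)) / c = x $ i" for i
    proof -
      have "\<bar>c * x $ i\<bar> \<le> c * K" using x[of i] c by (simp add: abs_mult)
      then have "\<bar>c * x $ i\<bar> \<le> pi / 2" using \<open>K > 0\<close> by (simp add: c_def)
      then have "arcsin (sin (c * x $ i)) = c * x $ i" by (intro arcsin_sin) auto
      then show ?thesis using c by simp
    qed
    then have "h (\<chi> i::'d. sin (c * x $ i)) = f x" by (simp add: h_def)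
    then show "\<bar>f x - Q x\<bar> \<le> \<delta>" using near[of x] by simp
  qed
qed

section \<open>Weak convergence in probability\<close>

lemma prob_measuresD:
  assumes "P \<in> prob_measures"
  shows "prob_space P" "sets P = sets borel" "space P = UNIV"
  using assms sets_eq_imp_space_eq[of P borel] by (auto simp: prob_measures_def)

lemma integrable_bounded_continuous:
  fixes f :: "'c::topological_space \<Rightarrow> 'e::{banach, second_countable_topology}"
  assumes "P \<in> prob_measures" "continuous_on UNIV f" "\<And>x. norm (f x) \<le> C"
  shows "integrable P f" "norm (\<integral>x. f x \<partial>P) \<le> C"
proof -
  interpret prob_space P by (rule prob_measuresD[OF assms(1)])
  have "f \<in> borel_measurable P"
    using borel_measurable_continuous_onI[OF assms(2)] measurable_cong_sets[OF prob_measuresD(2)[OF assms(1)] refl] by blast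
  then show i: "integrable P f" using assms(3) by (intro integrable_const_bound[of _ C]) auto
  have "norm (\<integral>x. f x \<partial>P) \<le> (\<integral>x. norm (f x) \<partial>P)" by (rule integral_norm_bound)
  also have "\<dots> \<le> (\<integral>x. C \<partial>P)" using i assms(3) by (intro integral_mono) auto
  finally show "norm (\<integral>x. f x \<partial>P) \<le> C" by (simp add: prob_space)
qed

text \<open>Induction over the generation of the topology: intersections add up two exceptional events, unions
select the member that contains the limit, and for a generator the exceptional event is bounded by
the Markov inequality.\<close>

lemma weak_nhds_in_probability:
  assumes "prob_space M"
    and meas: "\<And>n f. n \<ge> n0 \<Longrightarrow> continuous_on UNIV f \<Longrightarrow> bounded (range f) \<Longrightarrow>
      (\<lambda>\<omega>. \<integral>x. f x \<partial>L n \<omega> :: real) \<in> borel_measurable M"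
    and L: "\<And>n \<omega>. n \<ge> n0 \<Longrightarrow> \<omega> \<in> space M \<Longrightarrow> L n \<omega> \<in> prob_measures"
    and lim: "\<And>f :: 'c::topological_space \<Rightarrow> real. continuous_on UNIV f \<Longrightarrow> bounded (range f) \<Longrightarrow>
      (\<lambda>n. \<integral>\<omega>. \<bar>(\<integral>x. f x \<partial>L n \<omega>) - (\<integral>x. f x \<partial>P)\<bar> \<partial>M) \<longlonglongrightarrow> 0"
    and W: "openin weak_topology W" "P \<in> W"
  shows "\<exists>E. (\<forall>n. E n \<in> sets M) \<and> (\<lambda>n. measure M (E n)) \<longlonglongrightarrow> 0 \<and>
    (\<forall>n\<ge>n0. \<forall>\<omega>\<in>space M - E n. L n \<omega> \<in> W)"
proof -
  interpret prob_space M by fact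
  have "generate_topology_on {{P \<in> prob_measures. (\<integral>x. f x \<partial>P) \<in> V} | f V.
        continuous_on UNIV f \<and> bounded (range f) \<and> open (V :: real set)} W"
    using W(1) unfolding weak_topology_def openin_topology_generated_by_iff .
  then show ?thesis using W(2)
  proof induction
    case Empty
    then show ?case by simp
  next
    case (Int a b)
    then have ab: "P \<in> a" "P \<in> b" by auto
    obtain E where
      E: "\<forall>n. E n \<in> sets M" "(\<lambda>n. measure M (E n)) \<longlonglongrightarrow> 0" "\<forall>n\<ge>n0. \<forall>\<omega>\<in>space M - E n. L n \<omega> \<in> a"
      using Int.IH(1)[OF ab(1)] by blast
    obtain F where
      F: "\<forall>n. F n \<in> sets M" "(\<lambda>n. measure M (F n)) \<longlonglongrightarrow> 0" "\<forall>n\<ge>n0. \<forall>\<omega>\<in>space M - F n. L n \<omega> \<in> b"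
      using Int.IH(2)[OF ab(2)] by blast
    have "(\<lambda>n. measure M (E n \<union> F n)) \<longlonglongrightarrow> 0"
    proof (rule tendsto_sandwich[OF _ _ tendsto_const])
      show "(\<lambda>n. measure M (E n) + measure M (F n)) \<longlonglongrightarrow> 0" using tendsto_add[OF E(2) F(2)] by simp
    qed (use E(1) F(1) in \<open>auto intro!: always_eventually measure_Un_le\<close>)
    then show ?case using E F by (intro exI[of _ "\<lambda>n. E n \<union> F n"]) auto
  next
    case (UN K)
    then obtain k where k: "k \<in> K" "P \<in> k" by auto
    with UN.IH obtain E where E: "\<forall>n. E n \<in> sets M" "(\<lambda>n. measure M (E n)) \<longlonglongrightarrow> 0"
      "\<forall>n\<ge>n0. \<forall>\<omega>\<in>space M - E n. L n \<omega> \<in> k" by blast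
    then show ?case using k(1) by (intro exI[of _ E]) auto
  next
    case (Basis s)
    then obtain f and V :: "real set" where f: "continuous_on UNIV f" "bounded (range f)" "open V"
      and s: "s = {P \<in> prob_measures. (\<integral>x. f x \<partial>P) \<in> V}" by auto
    obtain r where r: "r > 0" "ball (\<integral>x. f x \<partial>P) r \<subseteq> V"
      using Basis(2) f(3) unfolding s by (auto elim: openE)
    obtain C where C: "\<And>x. norm (f x) \<le> C" using f(2) by (auto simp: bounded_iff)
    define D where "D n \<omega> = \<bar>(\<integral>x. f x \<partial>L n \<omega>) - (\<integral>x. f x \<partial>P)\<bar>" for n \<omega>
    have D_nonneg: "D n \<omega> \<ge> 0" for n \<omega> by (simp add: D_def)
    have Dm [measurable]: "D n \<in> borel_measurable M" if "n \<ge> n0" for n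
      unfolding D_def using meas[OF that f(1,2)] by measurable
    have P: "P \<in> prob_measures" using Basis(2) s by auto
    have Di: "integrable M (D n)" if "n \<ge> n0" for n
    proof (rule integrable_const_bound[of _ "2 * C"])
      show "AE \<omega> in M. norm (D n \<omega>) \<le> 2 * C"
        using integrable_bounded_continuous(2)[OF L[OF that] f(1) C] integrable_bounded_continuous(2)[OF P f(1) C]
        by (intro AE_I2) (fastforce simp: D_def)
    qed (rule Dm[OF that])
    \<comment> \<open>below \<open>n0\<close> the integrals need not be measurable in the sample point\<close>
    define E where "E n = (if n \<ge> n0 then {\<omega> \<in> space M. D n \<omega> \<ge> r} else {})" for n
    have Em: "E n \<in> sets M" for n using Dm[of n] by (auto simp: E_def)
    have "measure M (E n) \<le> (\<integral>\<omega>. D n \<omega> \<partial>M) / r" for n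
    proof (cases "n \<ge> n0")
      case True
      then show ?thesis
        using integral_Markov_inequality_measure[where A = "{}", OF Di[OF True] _ _ r(1)]
        by (simp add: E_def D_nonneg)
    qed (use r in \<open>auto simp: E_def D_def intro!: divide_nonneg_pos integral_nonneg\<close>)
    note markov = this
    have "(\<lambda>n. measure M (E n)) \<longlonglongrightarrow> 0"
    proof (rule tendsto_sandwich[OF _ _ tendsto_const])
      show "(\<lambda>n. (\<integral>\<omega>. D n \<omega> \<partial>M) / r) \<longlonglongrightarrow> 0"
        unfolding D_def using lim[OF f(1,2)] by (rule tendsto_divide_zero)
      show "\<forall>\<^sub>F n in sequentially. measure M (E n) \<le> (\<integral>\<omega>. D n \<omega> \<partial>M) / r"
        by (intro always_eventually allI markov)
    qed simp
    moreover have "L n \<omega> \<in> s" if "n \<ge> n0" "\<omega> \<in> space M - E n" for n \<omega>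
      using that r(2) L[OF that(1)] by (auto simp: s E_def D_def dist_real_def abs_minus_commute subset_iff)
    ultimately show ?case using Em by blast
  qed
qed

text \<open>A metric ball around the limit is a weak neighbourhood. Nothing guarantees that the event
\<open>d(L\<^sub>n, P) > \<epsilon>\<close> is measurable, which is why it is enclosed in measurable exceptional events.\<close>

lemma converges_in_probI:
  assumes "prob_space M"
    and meas: "\<And>n f. n \<ge> n0 \<Longrightarrow> continuous_on UNIV f \<Longrightarrow> bounded (range f) \<Longrightarrow>
      (\<lambda>\<omega>. \<integral>x. f x \<partial>L n \<omega> :: real) \<in> borel_measurable M"
    and L: "\<And>n \<omega>. n \<ge> n0 \<Longrightarrow> \<omega> \<in> space M \<Longrightarrow> L n \<omega> \<in> prob_measures"
    and P: "P \<in> prob_measures"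
    and lim: "\<And>f :: 'c::topological_space \<Rightarrow> real. continuous_on UNIV f \<Longrightarrow> bounded (range f) \<Longrightarrow>
      (\<lambda>n. \<integral>\<omega>. \<bar>(\<integral>x. f x \<partial>L n \<omega>) - (\<integral>x. f x \<partial>P)\<bar> \<partial>M) \<longlonglongrightarrow> 0"
  shows "converges_in_prob M weak_topology L P"
  unfolding converges_in_prob_def
proof (intro allI impI)
  fix m :: "'c measure metric" and \<epsilon> :: real
  assume m: "mtopology_of m = weak_topology" and \<epsilon>: "\<epsilon> > 0"
  interpret prob_space M by fact
  interpret m: Metric_space "mspace m" "mdist m" by (rule Metric_space_mspace_mdist)
  have "topspace weak_topology = (prob_measures :: 'c measure set)"
  proof
    show "prob_measures \<subseteq> topspace (weak_topology :: 'c measure topology)"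
      unfolding weak_topology_def topology_generated_by_topspace
      by (rule Union_upper) (auto intro!: exI[of _ "\<lambda>_. 0"] exI[of _ UNIV])
  qed (auto simp: weak_topology_def)
  then have "P \<in> mspace m" using P m by (metis topspace_mtopology_of)
  then have "P \<in> m.mball P \<epsilon>" using \<epsilon> by simp
  moreover have "openin weak_topology (m.mball P \<epsilon>)" using m by (metis m.openin_mball mtopology_of_def)
  ultimately have "\<exists>E. (\<forall>n. E n \<in> sets M) \<and> (\<lambda>n. measure M (E n)) \<longlonglongrightarrow> 0 \<and>
      (\<forall>n\<ge>n0. \<forall>\<omega>\<in>space M - E n. L n \<omega> \<in> m.mball P \<epsilon>)"
    by (intro weak_nhds_in_probability[OF \<open>prob_space M\<close> meas L lim])
  then obtain E where E: "\<And>n. E n \<in> sets M" "(\<lambda>n. measure M (E n)) \<longlonglongrightarrow> 0"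
    "\<And>n \<omega>. n \<ge> n0 \<Longrightarrow> \<omega> \<in> space M - E n \<Longrightarrow> L n \<omega> \<in> m.mball P \<epsilon>" by blast
  show "(\<lambda>n. measure M {\<omega> \<in> space M. mdist m (L n \<omega>) P > \<epsilon>}) \<longlonglongrightarrow> 0"
  proof (rule tendsto_sandwich[OF _ _ tendsto_const E(2)])
    show "\<forall>\<^sub>F n in sequentially. measure M {\<omega> \<in> space M. mdist m (L n \<omega>) P > \<epsilon>} \<le> measure M (E n)"
      using eventually_ge_at_top[of n0]
    proof eventually_elim
      case (elim n)
      have "{\<omega> \<in> space M. mdist m (L n \<omega>) P > \<epsilon>} \<subseteq> E n"
        using E(3)[OF elim] m.commute by fastforce
      then show ?case by (rule finite_measure_mono) (rule E(1))
    qed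
  qed auto
qed

lemma trig_poly_mean_convergence:
  fixes L :: "nat \<Rightarrow> 'a \<Rightarrow> 'v::real_inner measure"
  assumes "prob_space M"
    and L: "\<And>n \<omega>. n \<ge> n0 \<Longrightarrow> \<omega> \<in> space M \<Longrightarrow> L n \<omega> \<in> prob_measures"
    and meas: "\<And>n f. n \<ge> n0 \<Longrightarrow> continuous_on UNIV f \<Longrightarrow> bounded (range f) \<Longrightarrow>
      (\<lambda>\<omega>. \<integral>x. f x \<partial>L n \<omega> :: complex) \<in> borel_measurable M"
    and P: "P \<in> prob_measures"
    and char: "\<And>t. (\<lambda>n. \<integral>\<omega>. norm ((\<integral>x. cis (t \<bullet> x) \<partial>L n \<omega>) - (\<integral>x. cis (t \<bullet> x) \<partial>P)) \<partial>M) \<longlonglongrightarrow> 0"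
    and g: "trig_poly g"
  shows "(\<lambda>n. \<integral>\<omega>. norm ((\<integral>x. g x \<partial>L n \<omega>) - (\<integral>x. g x \<partial>P)) \<partial>M) \<longlonglongrightarrow> 0"
  using g
proof induction
  case (character t)
  show ?case by (rule char)
next
  case (scale f c)
  have "(\<lambda>n. norm c * (\<integral>\<omega>. norm ((\<integral>x. f x \<partial>L n \<omega>) - (\<integral>x. f x \<partial>P)) \<partial>M)) \<longlonglongrightarrow> 0"
    using scale.IH by (rule tendsto_mult_right_zero)
  then show ?case by (simp add: norm_mult flip: right_diff_distrib)
next
  case (add f g)
  interpret prob_space M by fact
  have int: "integrable M (\<lambda>\<omega>. norm ((\<integral>x. f x \<partial>L n \<omega>) - (\<integral>x. f x \<partial>P)))"
    if "trig_poly f" "n \<ge> n0" for f n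
  proof -
    note f = trig_poly_continuous_bounded[OF that(1)]
    obtain C where C: "\<And>x. norm (f x) \<le> C" using f(2) by (auto simp: bounded_iff)
    show ?thesis
    proof (rule integrable_const_bound[of _ "2 * C"])
      show "AE \<omega> in M. norm (norm ((\<integral>x. f x \<partial>L n \<omega>) - (\<integral>x. f x \<partial>P))) \<le> 2 * C"
        using integrable_bounded_continuous(2)[OF L[OF that(2)] f(1) C] integrable_bounded_continuous(2)[OF P f(1) C]
        by (intro AE_I2) (force intro: norm_triangle_ineq4[THEN order_trans])
    qed (use meas[OF that(2) f] in measurable)
  qed
  have split: "(\<integral>x. f x + g x \<partial>Q) = (\<integral>x. f x \<partial>Q) + (\<integral>x. g x \<partial>Q)" if Q: "Q \<in> prob_measures" for Q
  proof -
    obtain C D where "\<And>x. norm (f x) \<le> C" "\<And>x. norm (g x) \<le> D"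
      using add.hyps[THEN trig_poly_continuous_bounded(2)] by (auto simp: bounded_iff)
    then show ?thesis
      using add.hyps[THEN trig_poly_continuous_bounded(1)] Q
      by (intro Bochner_Integration.integral_add integrable_bounded_continuous(1)) auto
  qed
  show ?case
  proof (rule tendsto_sandwich[OF _ _ tendsto_const])
    show "(\<lambda>n. (\<integral>\<omega>. norm ((\<integral>x. f x \<partial>L n \<omega>) - (\<integral>x. f x \<partial>P)) \<partial>M)
      + (\<integral>\<omega>. norm ((\<integral>x. g x \<partial>L n \<omega>) - (\<integral>x. g x \<partial>P)) \<partial>M)) \<longlonglongrightarrow> 0"
      using tendsto_add[OF add.IH] by simp
    show "\<forall>\<^sub>F n in sequentially. (\<integral>\<omega>. norm ((\<integral>x. f x + g x \<partial>L n \<omega>) - (\<integral>x. f x + g x \<partial>P)) \<partial>M)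
      \<le> (\<integral>\<omega>. norm ((\<integral>x. f x \<partial>L n \<omega>) - (\<integral>x. f x \<partial>P)) \<partial>M)
      + (\<integral>\<omega>. norm ((\<integral>x. g x \<partial>L n \<omega>) - (\<integral>x. g x \<partial>P)) \<partial>M)"
      using eventually_ge_at_top[of n0]
    proof eventually_elim
      case (elim n)
      show ?case
        unfolding Bochner_Integration.integral_add[OF int[OF add.hyps(1) elim] int[OF add.hyps(2) elim], symmetric]
      proof (rule integral_mono)
        show "integrable M (\<lambda>\<omega>. norm ((\<integral>x. f x + g x \<partial>L n \<omega>) - (\<integral>x. f x + g x \<partial>P)))"
          using add.hyps elim by (intro int trig_poly.add)
        show "integrable M (\<lambda>\<omega>. norm ((\<integral>x. f x \<partial>L n \<omega>) - (\<integral>x. f x \<partial>P)) + norm ((\<integral>x. g x \<partial>L n \<omega>) - (\<integral>x. g x \<partial>P)))"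
          using int add.hyps elim by auto
        show "norm ((\<integral>x. f x + g x \<partial>L n \<omega>) - (\<integral>x. f x + g x \<partial>P))
          \<le> norm ((\<integral>x. f x \<partial>L n \<omega>) - (\<integral>x. f x \<partial>P)) + norm ((\<integral>x. g x \<partial>L n \<omega>) - (\<integral>x. g x \<partial>P))"
          if "\<omega> \<in> space M" for \<omega>
          unfolding split[OF P] split[OF L[OF elim that]] by (rule norm_diff_triangle_ineq)
      qed
    qed
  qed (auto intro!: always_eventually)
qed

lemma prob_outside_cube_tendsto_0:
  fixes P :: "(real ^ 'd::finite) measure"
  assumes "P \<in> prob_measures"
  shows "(\<lambda>k. measure P {x. \<exists>i. \<bar>x $ i\<bar> > real k}) \<longlonglongrightarrow> 0"
proof -
  interpret prob_space P by (rule prob_measuresD[OF assms])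
  let ?A = "\<lambda>k. {x :: real ^ 'd. \<exists>i. \<bar>x $ i\<bar> > real k}"
  have "open (?A k)" for k by (intro open_Collect_ex open_Collect_less continuous_intros)
  then have "range ?A \<subseteq> sets P" using prob_measuresD(2)[OF assms] by auto
  moreover have "decseq ?A" by (auto simp: decseq_def) (meson le_less_trans of_nat_mono)
  moreover have "(\<Inter>k. ?A k) = {}"
  proof -
    have "\<exists>k. x \<notin> ?A k" for x
    proof -
      obtain k where "norm x \<le> real k" using real_arch_simple by blast
      then have "x \<notin> ?A k" by (auto simp: not_less intro: order_trans[OF component_le_norm_cart])
      then show ?thesis ..
    qed
    then show ?thesis by blast
  qed
  ultimately show ?thesis using finite_Lim_measure_decseq[of ?A] by simp
qed

text \<open>A form of the continuity theorem for random measures: the assumptions are convergence in mean of the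
random characteristic functions and tightness through bounded second moments. The expected distance
of \<open>\<integral> f dL\<^sub>n\<close> from \<open>\<integral> f dP\<close> is split at a trigonometric polynomial \<open>Q\<close> that is close to \<open>f\<close> on a large
cube; outside the cube \<open>\<bar>f - Q\<bar>\<close> is bounded and the mass is small for both measures.\<close>

lemma characters_and_moments_imp_convergence:
  fixes L :: "nat \<Rightarrow> 'a \<Rightarrow> (real ^ 'd::finite) measure"
  assumes "prob_space M"
    and L: "\<And>n \<omega>. n \<ge> n0 \<Longrightarrow> \<omega> \<in> space M \<Longrightarrow> L n \<omega> \<in> prob_measures"
    and meas: "\<And>n f. n \<ge> n0 \<Longrightarrow> continuous_on UNIV f \<Longrightarrow> bounded (range f) \<Longrightarrow>
      (\<lambda>\<omega>. \<integral>x. f x \<partial>L n \<omega> :: complex) \<in> borel_measurable M"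
    and P: "P \<in> prob_measures"
    and char: "\<And>t. (\<lambda>n. \<integral>\<omega>. norm ((\<integral>x. cis (t \<bullet> x) \<partial>L n \<omega>) - (\<integral>x. cis (t \<bullet> x) \<partial>P)) \<partial>M) \<longlonglongrightarrow> 0"
    and mom1: "\<And>n \<omega> i. n \<ge> n0 \<Longrightarrow> \<omega> \<in> space M \<Longrightarrow> integrable (L n \<omega>) (\<lambda>x. (x $ i)\<^sup>2)"
    and mom2: "\<And>n i. n \<ge> n0 \<Longrightarrow> integrable M (\<lambda>\<omega>. \<integral>x. (x $ i)\<^sup>2 \<partial>L n \<omega>)"
    and mom3: "\<And>i. \<exists>C. \<forall>n\<ge>n0. (\<integral>\<omega>. \<integral>x. (x $ i)\<^sup>2 \<partial>L n \<omega> \<partial>M) \<le> C"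
  shows "converges_in_prob M weak_topology L P"
proof (rule converges_in_probI[OF \<open>prob_space M\<close> _ L P])
  interpret prob_space M by fact
  have int_of_real: "(\<integral>x. of_real (f x) \<partial>Q) = complex_of_real (\<integral>x. f x \<partial>Q)" for f :: "real ^ 'd \<Rightarrow> real" and Q
    by (rule integral_complex_of_real)
  show realm: "(\<lambda>\<omega>. \<integral>x. f x \<partial>L n \<omega>) \<in> borel_measurable M"
    if "n \<ge> n0" "continuous_on UNIV f" "bounded (range f)" for n and f :: "real ^ 'd \<Rightarrow> real"
  proof -
    have "continuous_on UNIV (\<lambda>x. complex_of_real (f x))" "bounded (range (\<lambda>x. complex_of_real (f x)))"
      using that by (auto intro!: continuous_intros simp: bounded_iff)
    from meas[OF that(1) this] have "(\<lambda>\<omega>. Re (of_real (\<integral>x. f x \<partial>L n \<omega>))) \<in> borel_measurable M"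
      unfolding int_of_real by measurable
    then show ?thesis by simp
  qed
  from mom3 obtain C' where C': "\<And>i n. n \<ge> n0 \<Longrightarrow> (\<integral>\<omega>. \<integral>x. (x $ i)\<^sup>2 \<partial>L n \<omega> \<partial>M) \<le> C' i" by metis
  define S where "S = (\<Sum>i\<in>UNIV. C' i)"
  fix f :: "real ^ 'd \<Rightarrow> real" assume f: "continuous_on UNIV f" "bounded (range f)"
  obtain C where C: "\<And>x. \<bar>f x\<bar> \<le> C" using f(2) by (auto simp: bounded_iff)
  then have "C \<ge> 0" using order_trans[OF abs_ge_zero] by blast
  show "(\<lambda>n. \<integral>\<omega>. \<bar>(\<integral>x. f x \<partial>L n \<omega>) - (\<integral>x. f x \<partial>P)\<bar> \<partial>M) \<longlonglongrightarrow> 0"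
  proof (rule LIMSEQ_I)
    fix \<epsilon> :: real assume \<epsilon>: "\<epsilon> > 0"
    define \<delta> where "\<delta> = min 1 (\<epsilon> / 8)"
    have \<delta>: "\<delta> > 0" "\<delta> \<le> 1" "\<delta> \<le> \<epsilon> / 8" using \<epsilon> by (auto simp: \<delta>_def)
    let ?O = "\<lambda>k :: nat. {x :: real ^ 'd. \<exists>i. \<bar>x $ i\<bar> > real k}"
    have "(\<lambda>k. (2 * C + 1) * measure P (?O k)) \<longlonglongrightarrow> 0"
      using prob_outside_cube_tendsto_0[OF P] by (rule tendsto_mult_right_zero)
    then have "\<forall>\<^sub>F k in sequentially. (2 * C + 1) * measure P (?O k) < \<epsilon> / 8"
      using \<epsilon> by (intro order_tendstoD) auto
    moreover have "(\<lambda>k. (2 * C + 1) * S * (inverse (real k) * inverse (real k))) \<longlonglongrightarrow> (2 * C + 1) * S * (0 * 0)"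
      by (intro tendsto_intros lim_inverse_n)
    \<comment> \<open>\<open>2 C + 1\<close> bounds \<open>\<bar>f - Q\<bar>\<close> everywhere, and \<open>S / k\<^sup>2\<close> the mean mass outside the cube of size \<open>k\<close>\<close>
    then have "\<forall>\<^sub>F k in sequentially. (2 * C + 1) * S * (inverse (real k) * inverse (real k)) < \<epsilon> / 8"
      using \<epsilon> by (intro order_tendstoD) auto
    moreover have "\<forall>\<^sub>F k in sequentially. k > (0::nat)" by (rule eventually_gt_at_top)
    ultimately have "\<forall>\<^sub>F k in sequentially. (2 * C + 1) * measure P (?O k) < \<epsilon> / 8 \<and>
      (2 * C + 1) * S * (inverse (real k) * inverse (real k)) < \<epsilon> / 8 \<and> k > 0"
      by (intro eventually_conj)
    then obtain k where k: "(2 * C + 1) * measure P (?O k) < \<epsilon> / 8"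
      "(2 * C + 1) * S * (inverse (real k) * inverse (real k)) < \<epsilon> / 8" "k > 0"
      using eventually_happens'[OF sequentially_bot] by blast
    define K where "K = real k"
    have K: "K > 0" using k by (simp add: K_def)
    obtain Q where Q: "trig_poly (\<lambda>x. of_real (Q x))" "\<And>x. \<bar>Q x\<bar> \<le> C + \<delta>"
      "\<And>x. (\<And>i. \<bar>x $ i\<bar> \<le> K) \<Longrightarrow> \<bar>f x - Q x\<bar> \<le> \<delta>"
      using trig_poly_approximation_on_cube[OF f(1) C K \<delta>(1)] by metis
    have "continuous_on UNIV (\<lambda>x. Re (of_real (Q x)))"
      by (intro continuous_intros trig_poly_continuous_bounded(1) Q(1))
    then have Qc: "continuous_on UNIV Q" by simp
    have Qb: "bounded (range Q)" using Q(2) by (auto simp: bounded_iff)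
    define R where "R = (2 * C + 1) * (inverse K * inverse K)"
    have R: "R \<ge> 0" using K \<open>C \<ge> 0\<close> by (simp add: R_def)
    have far: "\<bar>f x - Q x\<bar> \<le> 2 * C + 1" for x using C[of x] Q(2)[of x] \<delta> by linarith
    \<comment> \<open>the indicator bound serves the limit \<open>P\<close>, the quadratic bound the random measures\<close>
    have pt1: "\<bar>f x - Q x\<bar> \<le> \<delta> + (2 * C + 1) * indicator (?O k) x" for x
      using Q(3)[of x] far[of x] \<delta>(1) \<open>C \<ge> 0\<close> by (cases "x \<in> ?O k") (auto simp: K_def not_less)
    have pt2: "\<bar>f x - Q x\<bar> \<le> \<delta> + R * (\<Sum>i\<in>UNIV. (x $ i)\<^sup>2)" for x
    proof (cases "x \<in> ?O k")
      case True
      then obtain i where i: "\<bar>x $ i\<bar> > K" by (auto simp: K_def)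
      have "K\<^sup>2 \<le> \<bar>x $ i\<bar>\<^sup>2" using i K by (intro power_mono) auto
      also have "\<dots> \<le> (\<Sum>i\<in>UNIV. (x $ i)\<^sup>2)"
        using member_le_sum[of i UNIV "\<lambda>i. (x $ i)\<^sup>2"] by simp
      finally have "R * K\<^sup>2 \<le> R * (\<Sum>i\<in>UNIV. (x $ i)\<^sup>2)" using R by (rule mult_left_mono)
      moreover have "R * K\<^sup>2 = 2 * C + 1" using K by (simp add: R_def power2_eq_square field_simps)
      ultimately show ?thesis using far[of x] \<delta>(1) by linarith
    next
      case False
      then have "\<bar>f x - Q x\<bar> \<le> \<delta>" by (intro Q(3)) (auto simp: K_def not_less)
      then show ?thesis using mult_nonneg_nonneg[OF R sum_nonneg[of UNIV "\<lambda>i. (x $ i)\<^sup>2"]] by auto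
    qed
    have intf: "integrable A f" "integrable A Q" if "A \<in> prob_measures" for A
      using integrable_bounded_continuous(1)[OF that f(1), of C] C
        integrable_bounded_continuous(1)[OF that Qc, of "C + \<delta>"] Q(2) by auto
    have diff: "\<bar>(\<integral>x. f x \<partial>A) - (\<integral>x. Q x \<partial>A)\<bar> \<le> (\<integral>x. \<bar>f x - Q x\<bar> \<partial>A)" if "A \<in> prob_measures" for A
      unfolding Bochner_Integration.integral_diff[OF intf[OF that], symmetric] by (rule integral_abs_bound)
    have boundP: "\<bar>(\<integral>x. f x \<partial>P) - (\<integral>x. Q x \<partial>P)\<bar> \<le> \<epsilon> / 4"
    proof -
      interpret P: prob_space P by (rule prob_measuresD[OF P])
      have "open (?O k)" by (intro open_Collect_ex open_Collect_less continuous_intros)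
      then have O: "?O k \<in> sets P" by (simp add: prob_measuresD(2)[OF P])
      have "(\<integral>x. \<bar>f x - Q x\<bar> \<partial>P) \<le> (\<integral>x. \<delta> + (2 * C + 1) * indicator (?O k) x \<partial>P)"
        using intf[OF P] pt1 O by (intro integral_mono) (auto simp: P.emeasure_eq_measure)
      also have "\<dots> = \<delta> + (2 * C + 1) * measure P (?O k)"
        using O by (simp add: P.emeasure_eq_measure P.prob_space)
      finally show ?thesis using diff[OF P] k(1) \<delta>(3) by linarith
    qed
    have boundL: "\<bar>(\<integral>x. f x \<partial>L n \<omega>) - (\<integral>x. Q x \<partial>L n \<omega>)\<bar> \<le> \<delta> + R * (\<Sum>i\<in>UNIV. \<integral>x. (x $ i)\<^sup>2 \<partial>L n \<omega>)"
      if n: "n \<ge> n0" and \<omega>: "\<omega> \<in> space M" for n \<omega>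
    proof -
      interpret L: prob_space "L n \<omega>" by (rule prob_measuresD[OF L[OF that]])
      have "(\<integral>x. \<bar>f x - Q x\<bar> \<partial>L n \<omega>) \<le> (\<integral>x. \<delta> + R * (\<Sum>i\<in>UNIV. (x $ i)\<^sup>2) \<partial>L n \<omega>)"
        using intf[OF L[OF that]] pt2 mom1[OF that] by (intro integral_mono) auto
      also have "\<dots> = \<delta> + R * (\<Sum>i\<in>UNIV. \<integral>x. (x $ i)\<^sup>2 \<partial>L n \<omega>)"
        using mom1[OF that] by (simp add: L.prob_space)
      finally show ?thesis using diff[OF L[OF that]] by linarith
    qed
    have "(\<lambda>n. \<integral>\<omega>. norm ((\<integral>x. complex_of_real (Q x) \<partial>L n \<omega>) - (\<integral>x. of_real (Q x) \<partial>P)) \<partial>M) \<longlonglongrightarrow> 0"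
      by (rule trig_poly_mean_convergence[OF \<open>prob_space M\<close> L meas P char Q(1)])
    moreover have "norm ((\<integral>x. complex_of_real (Q x) \<partial>L n \<omega>) - (\<integral>x. of_real (Q x) \<partial>P))
        = \<bar>(\<integral>x. Q x \<partial>L n \<omega>) - (\<integral>x. Q x \<partial>P)\<bar>" for n \<omega>
      unfolding int_of_real by (simp flip: of_real_diff)
    ultimately have "(\<lambda>n. \<integral>\<omega>. \<bar>(\<integral>x. Q x \<partial>L n \<omega>) - (\<integral>x. Q x \<partial>P)\<bar> \<partial>M) \<longlonglongrightarrow> 0"
      by (simp only:)
    then have "\<forall>\<^sub>F n in sequentially. (\<integral>\<omega>. \<bar>(\<integral>x. Q x \<partial>L n \<omega>) - (\<integral>x. Q x \<partial>P)\<bar> \<partial>M) < \<epsilon> / 4"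
      using \<epsilon> by (intro order_tendstoD) auto
    then obtain n1 where n1: "\<And>n. n \<ge> n1 \<Longrightarrow> (\<integral>\<omega>. \<bar>(\<integral>x. Q x \<partial>L n \<omega>) - (\<integral>x. Q x \<partial>P)\<bar> \<partial>M) < \<epsilon> / 4"
      by (auto simp: eventually_sequentially)
    have intM: "integrable M (\<lambda>\<omega>. \<bar>(\<integral>x. g x \<partial>L n \<omega>) - (\<integral>x. g x \<partial>P)\<bar>)"
      if "n \<ge> n0" and g: "continuous_on UNIV g" "bounded (range g)" for n and g :: "real ^ 'd \<Rightarrow> real"
    proof -
      obtain D where D: "\<And>x. norm (g x) \<le> D" using g(2) by (auto simp: bounded_iff)
      show ?thesis
      proof (rule integrable_const_bound[of _ "2 * D"])
        show "AE \<omega> in M. norm \<bar>(\<integral>x. g x \<partial>L n \<omega>) - (\<integral>x. g x \<partial>P)\<bar> \<le> 2 * D"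
          using integrable_bounded_continuous(2)[OF L[OF that(1)] g(1) D] integrable_bounded_continuous(2)[OF P g(1) D]
          by (intro AE_I2) fastforce
      qed (use realm[OF that] in measurable)
    qed
    show "\<exists>no. \<forall>n\<ge>no. norm ((\<integral>\<omega>. \<bar>(\<integral>x. f x \<partial>L n \<omega>) - (\<integral>x. f x \<partial>P)\<bar> \<partial>M) - 0) < \<epsilon>"
    proof (intro exI[of _ "max n0 n1"] allI impI)
      fix n assume "max n0 n1 \<le> n"
      then have n: "n \<ge> n0" "n \<ge> n1" by auto
      have "(\<integral>\<omega>. \<bar>(\<integral>x. f x \<partial>L n \<omega>) - (\<integral>x. f x \<partial>P)\<bar> \<partial>M)
        \<le> (\<integral>\<omega>. \<delta> + R * (\<Sum>i\<in>UNIV. \<integral>x. (x $ i)\<^sup>2 \<partial>L n \<omega>) + \<epsilon> / 4 + \<bar>(\<integral>x. Q x \<partial>L n \<omega>) - (\<integral>x. Q x \<partial>P)\<bar> \<partial>M)"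
      proof (rule integral_mono)
        show "integrable M (\<lambda>\<omega>. \<bar>(\<integral>x. f x \<partial>L n \<omega>) - (\<integral>x. f x \<partial>P)\<bar>)" using n f by (intro intM)
        show "integrable M (\<lambda>\<omega>. \<delta> + R * (\<Sum>i\<in>UNIV. \<integral>x. (x $ i)\<^sup>2 \<partial>L n \<omega>) + \<epsilon> / 4 + \<bar>(\<integral>x. Q x \<partial>L n \<omega>) - (\<integral>x. Q x \<partial>P)\<bar>)"
          using intM[OF n(1) Qc Qb] mom2[OF n(1)] by auto
        show "\<bar>(\<integral>x. f x \<partial>L n \<omega>) - (\<integral>x. f x \<partial>P)\<bar> \<le> \<delta> + R * (\<Sum>i\<in>UNIV. \<integral>x. (x $ i)\<^sup>2 \<partial>L n \<omega>) + \<epsilon> / 4 + \<bar>(\<integral>x. Q x \<partial>L n \<omega>) - (\<integral>x. Q x \<partial>P)\<bar>"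
          if "\<omega> \<in> space M" for \<omega> using boundL[OF n(1) that] boundP by linarith
      qed
      also have "\<dots> = \<delta> + R * (\<Sum>i\<in>UNIV. \<integral>\<omega>. \<integral>x. (x $ i)\<^sup>2 \<partial>L n \<omega> \<partial>M) + \<epsilon> / 4 + (\<integral>\<omega>. \<bar>(\<integral>x. Q x \<partial>L n \<omega>) - (\<integral>x. Q x \<partial>P)\<bar> \<partial>M)"
        using intM[OF n(1) Qc Qb] mom2[OF n(1)] by (simp add: prob_space)
      also have "\<dots> \<le> \<delta> + R * S + \<epsilon> / 4 + (\<integral>\<omega>. \<bar>(\<integral>x. Q x \<partial>L n \<omega>) - (\<integral>x. Q x \<partial>P)\<bar> \<partial>M)"
        unfolding S_def using R C'[OF n(1)] by (intro add_mono mult_left_mono sum_mono) auto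
      also have "\<dots> < \<epsilon>"
      proof -
        have "R * S < \<epsilon> / 8" using k(2) by (simp add: R_def K_def mult_ac)
        then show ?thesis using n1[OF n(2)] \<delta>(3) \<epsilon> by linarith
      qed
      finally show "norm ((\<integral>\<omega>. \<bar>(\<integral>x. f x \<partial>L n \<omega>) - (\<integral>x. f x \<partial>P)\<bar> \<partial>M) - 0) < \<epsilon>"
        by (simp add: integral_nonneg)
    qed
  qed
qed

section \<open>A product limit and a second order expansion\<close>

lemma norm_exp_minus_one_minus:
  fixes z :: complex
  assumes "norm z \<le> 1"
  shows "norm (exp z - 1 - z) \<le> exp 1 * (norm z)\<^sup>2"
proof -
  have "norm (exp z - (\<Sum>k\<le>1. z ^ k / fact k)) \<le> exp \<bar>Re z\<bar> * norm z ^ Suc 1 / fact 1" by (rule Taylor_exp)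
  also have "\<dots> \<le> exp 1 * (norm z)\<^sup>2"
    using abs_Re_le_cmod[of z] assms by (simp add: power2_eq_square mult_right_mono)
  finally show ?thesis by (simp add: diff_diff_eq)
qed

text \<open>Both products have factors in the unit disc, so their distance is at most the sum of the distances of
the factors. The hypothesis \<open>\<bar>1 + w\<bar> \<le> 1\<close> supplies this: \<open>1 + w/(j+2)\<close> is a convex combination of \<open>1\<close>
and \<open>1 + w\<close>, and \<open>Re w \<le> 0\<close>.\<close>

lemma prod_near_exp_sum:
  fixes w :: complex
  assumes w: "norm (1 + w) \<le> 1"
  shows "norm ((\<Prod>j<n. 1 + w / of_nat (j + 2)) - exp (w * of_real (\<Sum>j<n. 1 / real (j + 2))))
    \<le> exp 1 * (norm w)\<^sup>2"
proof -
  have w2: "norm w \<le> 2" using norm_triangle_ineq4[of "1 + w" 1] w by simp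
  have Re: "Re w \<le> 0" using complex_Re_le_cmod[of "1 + w"] w by simp
  have e: "exp (w * of_real (\<Sum>j<n. 1 / real (j + 2))) = (\<Prod>j<n. exp (w / of_nat (j + 2)))"
    by (subst exp_sum[symmetric]) (auto simp: sum_distrib_left)
  have small: "norm (w / of_nat (j + 2)) \<le> 1" for j
    unfolding norm_divide norm_of_nat using w2 by (simp add: field_simps)
  have "norm (1 + w / of_nat (j + 2)) \<le> 1" for j
  proof -
    have "of_nat (j + 2) \<noteq> (0::complex)" by (simp only: of_nat_eq_0_iff)
    moreover have "of_nat (j + 1) + (1 + w) = of_nat (j + 2) + w" by simp
    ultimately have "1 + w / of_nat (j + 2) = (of_nat (j + 1) + (1 + w)) / of_nat (j + 2)"
      by (metis add_divide_distrib divide_self)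
    moreover have "norm (of_nat (j + 1) + (1 + w)) \<le> real (j + 1) + 1"
      using norm_triangle_ineq[of "of_nat (j + 1)" "1 + w"] w by (simp only: norm_of_nat)
    ultimately show ?thesis by (simp add: norm_divide del: of_nat_add of_nat_Suc)
  qed
  moreover have "norm (exp (w / of_nat (j + 2))) \<le> 1" for j
    using Re by (simp add: norm_exp_eq_Re Re_divide_of_nat divide_nonpos_pos)
  ultimately have "norm ((\<Prod>j<n. 1 + w / of_nat (j + 2)) - (\<Prod>j<n. exp (w / of_nat (j + 2))))
      \<le> (\<Sum>j<n. norm ((1 + w / of_nat (j + 2)) - exp (w / of_nat (j + 2))))"
    by (intro norm_prod_diff) auto
  \<comment> \<open>\<open>1/(j+2)\<^sup>2\<close> is replaced by a telescoping majorant\<close>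
  also have "\<dots> \<le> (\<Sum>j<n. exp 1 * (norm w)\<^sup>2 * (1 / real (j + 1) - 1 / real (j + 2)))"
  proof (rule sum_mono)
    fix j
    have "norm ((1 + w / of_nat (j + 2)) - exp (w / of_nat (j + 2)))
        = norm (exp (w / of_nat (j + 2)) - 1 - w / of_nat (j + 2))"
      by (simp add: norm_minus_commute diff_diff_eq)
    also have "\<dots> \<le> exp 1 * (norm (w / of_nat (j + 2)))\<^sup>2"
      by (rule norm_exp_minus_one_minus[OF small])
    also have "\<dots> = exp 1 * (norm w)\<^sup>2 * (1 / (real (j + 2))\<^sup>2)"
      by (simp only: norm_divide norm_of_nat power_divide) simp
    also have "\<dots> \<le> exp 1 * (norm w)\<^sup>2 * (1 / real (j + 1) - 1 / real (j + 2))"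
    proof (intro mult_left_mono)
      have "1 / (real (j + 2))\<^sup>2 \<le> 1 / (real (j + 1) * real (j + 2))"
        by (intro divide_left_mono) (auto simp: power2_eq_square)
      also have "\<dots> = 1 / real (j + 1) - 1 / real (j + 2)" by (simp add: divide_simps)
      finally show "1 / (real (j + 2))\<^sup>2 \<le> 1 / real (j + 1) - 1 / real (j + 2)" .
    qed simp
    finally show "norm ((1 + w / of_nat (j + 2)) - exp (w / of_nat (j + 2)))
      \<le> exp 1 * (norm w)\<^sup>2 * (1 / real (j + 1) - 1 / real (j + 2))" .
  qed
  also have "\<dots> = exp 1 * (norm w)\<^sup>2 * (1 - 1 / real (n + 1))"
  proof -
    have "(\<Sum>j<n. 1 / real (j + 1) - 1 / real (j + 2)) = 1 - 1 / real (n + 1)" by (induction n) simp_all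
    then show ?thesis by (simp only: flip: sum_distrib_left)
  qed
  also have "\<dots> \<le> exp 1 * (norm w)\<^sup>2"
    by (intro mult_left_le) auto
  finally show ?thesis unfolding e .
qed

lemma harmonic_tail_minus_ln:
  "(\<lambda>n. (\<Sum>j<n. 1 / real (j + 2)) - ln (real n)) \<longlonglongrightarrow> euler_mascheroni - 1"
proof -
  have h: "(\<Sum>j<n. 1 / real (j + 2)) = harm n - 1 + 1 / real (n + 1)" for n
    by (induction n) (simp_all add: harm_Suc inverse_eq_divide harm_expand)
  have "(\<lambda>n. (harm n - ln (real n)) - 1 + 1 / real (n + 1)) \<longlonglongrightarrow> euler_mascheroni - 1 + 0"
    using euler_mascheroni_LIMSEQ LIMSEQ_inverse_real_of_nat
    by (intro tendsto_intros) (auto simp: inverse_eq_divide)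
  moreover have "(\<Sum>j<n. 1 / real (j + 2)) - ln (real n) = (harm n - ln (real n)) - 1 + 1 / real (n + 1)" for n
    unfolding h by simp
  ultimately show ?thesis by (simp only: add_0_right)
qed

text \<open>Here \<open>\<phi> n\<close> stands for a characteristic function at an argument of order \<open>1/\<surd>(ln n)\<close> and \<open>a n\<close> for the
first order term of its expansion. The bounded difference of the harmonic sum and \<open>ln n\<close> is harmless
because it is multiplied by \<open>\<phi> n - 1\<close>, which tends to \<open>0\<close>.\<close>

lemma mean_product_limit:
  fixes \<phi> :: "nat \<Rightarrow> complex" and a :: "nat \<Rightarrow> real"
  assumes le1: "\<And>n. norm (\<phi> n) \<le> 1" and to1: "\<phi> \<longlonglongrightarrow> 1"
    and exp: "(\<lambda>n. of_real (ln (real n)) * (\<phi> n - 1 - \<i> * of_real (a n))) \<longlonglongrightarrow> c"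
  shows "(\<lambda>n. cis (- (ln (real n) * a n)) * (\<Prod>j<n. 1 + (\<phi> n - 1) / of_nat (j + 2))) \<longlonglongrightarrow> exp c"
proof -
  define w where "w n = \<phi> n - 1" for n
  define h where "h n = (\<Sum>j<n. 1 / real (j + 2))" for n :: nat
  have w0: "w \<longlonglongrightarrow> 0" using tendsto_diff[OF to1 tendsto_const[of 1]] by (simp add: w_def[abs_def])
  have "(\<lambda>n. w n * of_real (h n - ln (real n)) + of_real (ln (real n)) * (\<phi> n - 1 - \<i> * of_real (a n)))
      \<longlonglongrightarrow> 0 * of_real (euler_mascheroni - 1) + c"
    unfolding h_def by (intro tendsto_intros w0 exp harmonic_tail_minus_ln)
  then have "(\<lambda>n. exp (w n * of_real (h n - ln (real n)) + of_real (ln (real n)) * (\<phi> n - 1 - \<i> * of_real (a n))))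
      \<longlonglongrightarrow> exp c" by (intro tendsto_exp) simp
  moreover have "exp (w n * of_real (h n - ln (real n)) + of_real (ln (real n)) * (\<phi> n - 1 - \<i> * of_real (a n)))
      = cis (- (ln (real n) * a n)) * exp (w n * of_real (h n))" for n
    by (simp add: cis_conv_exp w_def algebra_simps flip: exp_add)
  ultimately have main: "(\<lambda>n. cis (- (ln (real n) * a n)) * exp (w n * of_real (h n))) \<longlonglongrightarrow> exp c" by simp
  have "(\<lambda>n. cis (- (ln (real n) * a n)) * ((\<Prod>j<n. 1 + w n / of_nat (j + 2)) - exp (w n * of_real (h n)))) \<longlonglongrightarrow> 0"
  proof (rule Lim_null_comparison)
    show "\<forall>\<^sub>F n in sequentially. norm (cis (- (ln (real n) * a n)) * ((\<Prod>j<n. 1 + w n / of_nat (j + 2)) - exp (w n * of_real (h n))))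
        \<le> exp 1 * (norm (w n))\<^sup>2"
      using prod_near_exp_sum[of "w n" n for n] le1 by (intro always_eventually) (simp add: norm_mult w_def h_def)
    have "(\<lambda>n. exp 1 * (norm (w n))\<^sup>2) \<longlonglongrightarrow> exp 1 * (norm (0::complex))\<^sup>2"
      by (intro tendsto_intros w0)
    then show "(\<lambda>n. exp 1 * (norm (w n))\<^sup>2) \<longlonglongrightarrow> 0" by simp
  qed
  from tendsto_add[OF main this] show ?thesis by (simp add: w_def algebra_simps)
qed

lemma cis_second_order_limit:
  fixes x :: real and r :: "nat \<Rightarrow> real"
  assumes r: "filterlim r at_top sequentially"
  shows "(\<lambda>n. of_real (r n) * (cis (x / sqrt (r n)) - 1 - \<i> * of_real (x / sqrt (r n)))) \<longlonglongrightarrow> - of_real (x\<^sup>2 / 2)"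
proof -
  define D where "D n = cis (x / sqrt (r n)) - 1 - \<i> * of_real (x / sqrt (r n)) + of_real ((x / sqrt (r n))\<^sup>2 / 2)" for n
  have D: "norm (D n) \<le> \<bar>x / sqrt (r n)\<bar> ^ 3 / 6" for n
  proof -
    have "cmod (iexp (x / sqrt (r n)) - (\<Sum>k\<le>2. (\<i> * (x / sqrt (r n)))^k / fact k)) \<le> \<bar>x / sqrt (r n)\<bar>^(Suc 2) / fact (Suc 2)"
      by (rule iexp_approx1)
    also have "iexp (x / sqrt (r n)) - (\<Sum>k\<le>2. (\<i> * (x / sqrt (r n)))^k / fact k) = D n"
      unfolding D_def cis_conv_exp numeral_2_eq_2 by (simp add: diff_diff_eq) (simp add: algebra_simps flip: of_real_mult)
    finally show ?thesis by (simp add: numeral_3_eq_3 fact_numeral)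
  qed
  have pos: "\<forall>\<^sub>F n in sequentially. r n > 0" using r by (simp add: filterlim_at_top_dense)
  have "(\<lambda>n. of_real (r n) * D n) \<longlonglongrightarrow> 0"
  proof (rule Lim_null_comparison)
    show "\<forall>\<^sub>F n in sequentially. norm (of_real (r n) * D n) \<le> \<bar>x\<bar> ^ 3 / 6 * inverse (sqrt (r n))"
      using pos
    proof eventually_elim
      case (elim n)
      have "norm (of_real (r n) * D n) \<le> r n * (\<bar>x / sqrt (r n)\<bar> ^ 3 / 6)"
        using elim D[of n] by (simp add: norm_mult mult_left_mono)
      also have "\<dots> = \<bar>x\<bar> ^ 3 / 6 * (r n / sqrt (r n) ^ 3)" using elim by (simp add: power_divide abs_divide ac_simps)
      also have "r n / sqrt (r n) ^ 3 = inverse (sqrt (r n))"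
      proof -
        have "sqrt (r n) ^ 3 = r n * sqrt (r n)" using elim by (simp add: power3_eq_cube)
        then show ?thesis using elim by (simp add: field_simps)
      qed
      finally show ?case .
    qed
    have "filterlim (\<lambda>n. sqrt (r n)) at_top sequentially" by (rule filterlim_compose[OF sqrt_at_top r])
    then have "(\<lambda>n. inverse (sqrt (r n))) \<longlonglongrightarrow> 0" by (rule tendsto_inverse_0_at_top)
    then show "(\<lambda>n. \<bar>x\<bar> ^ 3 / 6 * inverse (sqrt (r n))) \<longlonglongrightarrow> 0" by (rule tendsto_mult_right_zero)
  qed
  then have "(\<lambda>n. of_real (r n) * D n - of_real (x\<^sup>2 / 2)) \<longlonglongrightarrow> 0 - of_real (x\<^sup>2 / 2)"
    by (intro tendsto_intros)
  moreover have "\<forall>\<^sub>F n in sequentially. of_real (r n) * D n - of_real (x\<^sup>2 / 2)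
      = of_real (r n) * (cis (x / sqrt (r n)) - 1 - \<i> * of_real (x / sqrt (r n)))"
    using pos
  proof eventually_elim
    case (elim n)
    have "of_real (r n) * complex_of_real ((x / sqrt (r n))\<^sup>2 / 2) = of_real (x\<^sup>2 / 2)"
    proof -
      have "r n * ((x / sqrt (r n))\<^sup>2 / 2) = x\<^sup>2 / 2" using elim by (simp add: power_divide)
      then show ?thesis by (simp only: flip: of_real_mult)
    qed
    then show ?case by (simp add: D_def distrib_left)
  qed
  ultimately show ?thesis by (simp add: tendsto_cong)
qed

lemma real_vec_add: "real_vec (v + w) = real_vec v + real_vec w"
  by (simp add: real_vec_def vec_eq_iff)

lemma ln_real_at_top: "filterlim (\<lambda>n. ln (real n)) at_top sequentially"
  by (rule filterlim_compose[OF ln_at_top filterlim_real_sequentially])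

lemma (in prob_space) integral_norm_le_sqrt:
  fixes Y :: "'a \<Rightarrow> 'e::{banach, second_countable_topology}"
  assumes "integrable M Y" "integrable M (\<lambda>\<omega>. (norm (Y \<omega>))\<^sup>2)"
  shows "(\<integral>\<omega>. norm (Y \<omega>) \<partial>M) \<le> sqrt (\<integral>\<omega>. (norm (Y \<omega>))\<^sup>2 \<partial>M)"
proof -
  have "(\<integral>\<omega>. norm (Y \<omega>) \<partial>M)\<^sup>2 \<le> (\<integral>\<omega>. (norm (Y \<omega>))\<^sup>2 \<partial>M)"
    using variance_positive[of "\<lambda>\<omega>. norm (Y \<omega>)"] assms by (subst (asm) variance_eq) auto
  then show ?thesis by (rule real_le_rsqrt)
qed

section \<open>Linear statistics of the urn\<close>

locale finite_step_urn = infinite_color_urn M p u0 Z U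
  for M :: "'a measure" and p :: "int ^ 'd::finite \<Rightarrow> real" and u0 :: "int ^ 'd \<Rightarrow> real"
    and Z :: "nat \<Rightarrow> 'a \<Rightarrow> int ^ 'd" and U :: "nat \<Rightarrow> 'a \<Rightarrow> int ^ 'd \<Rightarrow> real" +
  fixes B :: "(int ^ 'd) set"
  assumes finite_B: "finite B" and p_nonneg: "\<And>u. p u \<ge> 0"
    and p_outside: "\<And>u. u \<notin> B \<Longrightarrow> p u = 0" and p_sum: "(\<Sum>u\<in>B. p u) = 1"
begin

text \<open>The transition operator of the random walk: the expectation of \<open>f\<close> one increment after \<open>v\<close>.\<close>

definition step :: "(int ^ 'd \<Rightarrow> 'e::real_vector) \<Rightarrow> int ^ 'd \<Rightarrow> 'e" where
  "step f v = (\<Sum>u\<in>B. p u *\<^sub>R f (v + u))"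

text \<open>The linear statistic \<open>\<Sum>\<^sub>v U\<^sub>n(v) f(v)\<close>, written in terms of the draws. In this form it is visibly a
measurable function, for every sample point and without a sum over an unbounded set of colours. The
two forms are identified in \<open>tally_eq_sum\<close>.\<close>

definition tally :: "nat \<Rightarrow> (int ^ 'd \<Rightarrow> 'e::real_vector) \<Rightarrow> 'a \<Rightarrow> 'e" where
  "tally n f \<omega> = (\<Sum>v | u0 v \<noteq> 0. u0 v *\<^sub>R f v) + (\<Sum>k<n. step f (Z k \<omega>))"

lemma tally_Suc: "tally (Suc n) f \<omega> = tally n f \<omega> + step f (Z n \<omega>)"
  by (simp add: tally_def)

lemma U_eq: "\<omega> \<in> space M \<Longrightarrow> U n \<omega> v = u0 v + (\<Sum>k<n. p (v - Z k \<omega>))"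
  by (induction n) (simp_all add: start evolution replacement_matrix_def)

lemma U_nonneg: "\<omega> \<in> space M \<Longrightarrow> U n \<omega> v \<ge> 0"
  by (simp add: U_eq init_nonneg p_nonneg sum_nonneg)

text \<open>All contributions to \<open>U\<^sub>n(v)\<close> are nonnegative, so a colour of mass \<open>0\<close> receives none of them, and
each of the sums over increments can be restricted to \<open>F\<close>.\<close>

lemma tally_eq_sum:
  assumes \<omega>: "\<omega> \<in> space M" and F: "finite F" "\<And>v. v \<notin> F \<Longrightarrow> U n \<omega> v = 0"
  shows "tally n f \<omega> = (\<Sum>v\<in>F. U n \<omega> v *\<^sub>R f v)"
proof -
  have zero: "u0 v = 0 \<and> (\<forall>k<n. p (v - Z k \<omega>) = 0)" if "v \<notin> F" for v
  proof -
    have "u0 v + (\<Sum>k<n. p (v - Z k \<omega>)) = 0" using F(2)[OF that] U_eq[OF \<omega>] by simp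
    then have "u0 v = 0" "(\<Sum>k<n. p (v - Z k \<omega>)) = 0"
      using init_nonneg[of v] sum_nonneg[of "{..<n}" "\<lambda>k. p (v - Z k \<omega>)"] p_nonneg by (auto simp: add_nonneg_eq_0_iff)
    then show ?thesis by (simp add: sum_nonneg_eq_0_iff p_nonneg)
  qed
  have "(\<Sum>v\<in>F. u0 v *\<^sub>R f v) = (\<Sum>v | u0 v \<noteq> 0. u0 v *\<^sub>R f v)"
    using zero by (intro sum.mono_neutral_right F) auto
  moreover have "(\<Sum>v\<in>F. p (v - Z k \<omega>) *\<^sub>R f v) = step f (Z k \<omega>)" if "k < n" for k
  proof -
    have "step f (Z k \<omega>) = (\<Sum>v\<in>(+) (Z k \<omega>) ` B. p (v - Z k \<omega>) *\<^sub>R f v)"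
      unfolding step_def by (subst sum.reindex) (auto simp: inj_on_def)
    also have "\<dots> = (\<Sum>v | p (v - Z k \<omega>) \<noteq> 0. p (v - Z k \<omega>) *\<^sub>R f v)"
    proof (intro sum.mono_neutral_right finite_imageI finite_B subsetI)
      fix v assume "v \<in> {v. p (v - Z k \<omega>) \<noteq> 0}"
      then have "v - Z k \<omega> \<in> B" using p_outside by blast
      then have "Z k \<omega> + (v - Z k \<omega>) \<in> (+) (Z k \<omega>) ` B" by (rule imageI)
      then show "v \<in> (+) (Z k \<omega>) ` B" by simp
    qed auto
    also have "\<dots> = (\<Sum>v\<in>F. p (v - Z k \<omega>) *\<^sub>R f v)"
      using zero that by (intro sum.mono_neutral_left F) auto
    finally show ?thesis by simp
  qed
  ultimately have "tally n f \<omega> = (\<Sum>v\<in>F. u0 v *\<^sub>R f v) + (\<Sum>k<n. \<Sum>v\<in>F. p (v - Z k \<omega>) *\<^sub>R f v)"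
    by (simp add: tally_def)
  also have "\<dots> = (\<Sum>v\<in>F. U n \<omega> v *\<^sub>R f v)"
    by (subst sum.swap) (simp add: U_eq[OF \<omega>] scaleR_add_left scaleR_sum_left sum.distrib)
  finally show ?thesis .
qed

lemma finite_support_U: "\<omega> \<in> space M \<Longrightarrow> finite {v. U n \<omega> v \<noteq> 0}"
proof (rule finite_subset)
  assume \<omega>: "\<omega> \<in> space M"
  show "{v. U n \<omega> v \<noteq> 0} \<subseteq> {v. u0 v \<noteq> 0} \<union> (\<Union>k<n. (+) (Z k \<omega>) ` B)"
  proof
    fix v assume "v \<in> {v. U n \<omega> v \<noteq> 0}"
    then have "u0 v \<noteq> 0 \<or> (\<exists>k<n. p (v - Z k \<omega>) \<noteq> 0)"
      using U_eq[OF \<omega>, of n v] by (force intro!: sum.neutral)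
    moreover have "v \<in> (+) (Z k \<omega>) ` B" if "p (v - Z k \<omega>) \<noteq> 0" for k
      using that p_outside[of "v - Z k \<omega>"] by (intro image_eqI[of _ _ "v - Z k \<omega>"]) auto
    ultimately show "v \<in> {v. u0 v \<noteq> 0} \<union> (\<Union>k<n. (+) (Z k \<omega>) ` B)" by blast
  qed
qed (use init_finite finite_B in auto)

lemma tally_const: "tally n (\<lambda>_. c) \<omega> = (real n + 1) *\<^sub>R c"
proof -
  have "tally n (\<lambda>_. c) \<omega> = (\<Sum>v | u0 v \<noteq> 0. u0 v) *\<^sub>R c + (\<Sum>k<n. (\<Sum>u\<in>B. p u) *\<^sub>R c)"
    by (simp only: tally_def step_def scaleR_sum_left)
  then show ?thesis by (simp add: init_sum p_sum sum_constant_scaleR scaleR_add_left add.commute del: sum_constant)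
qed

lemma norm_step_le:
  fixes f :: "int ^ 'd \<Rightarrow> 'e::real_normed_vector"
  assumes "\<And>v. norm (f v) \<le> C" shows "norm (step f v) \<le> C"
proof -
  have "norm (step f v) \<le> (\<Sum>u\<in>B. p u * C)"
    unfolding step_def using assms p_nonneg by (intro sum_norm_le) (auto intro: mult_left_mono)
  then show ?thesis by (simp add: p_sum flip: sum_distrib_right)
qed

lemma norm_tally_le:
  fixes f :: "int ^ 'd \<Rightarrow> 'e::real_normed_vector"
  assumes "\<And>v. norm (f v) \<le> C" shows "norm (tally n f \<omega>) \<le> (real n + 1) * C"
proof -
  have "norm (tally n f \<omega>) \<le> norm (\<Sum>v | u0 v \<noteq> 0. u0 v *\<^sub>R f v) + norm (\<Sum>k<n. step f (Z k \<omega>))"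
    unfolding tally_def by (rule norm_triangle_ineq)
  also have "norm (\<Sum>v | u0 v \<noteq> 0. u0 v *\<^sub>R f v) \<le> (\<Sum>v | u0 v \<noteq> 0. u0 v * C)"
    using assms init_nonneg by (intro sum_norm_le) (auto intro: mult_left_mono)
  also have "\<dots> = C" by (simp add: init_sum flip: sum_distrib_right)
  also have "norm (\<Sum>k<n. step f (Z k \<omega>)) \<le> (\<Sum>k<n. C)"
    by (intro sum_norm_le norm_step_le assms)
  finally show ?thesis by (simp add: algebra_simps)
qed

lemma tally_measurable [measurable]:
  fixes f :: "int ^ 'd \<Rightarrow> 'e::{real_normed_vector, second_countable_topology}"
  shows "tally n f \<in> borel_measurable M"
proof -
  have "(\<lambda>\<omega>. step f (Z k \<omega>)) \<in> borel_measurable M" for k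
    by (rule measurable_compose[OF color]) simp
  then show ?thesis unfolding tally_def[abs_def] by measurable
qed

lemma U_measurable [measurable]: "(\<lambda>\<omega>. U n \<omega> v) \<in> borel_measurable M"
proof -
  have "(\<lambda>\<omega>. p (v - Z k \<omega>)) \<in> borel_measurable M" for k
    by (rule measurable_compose[OF color]) simp
  then have "(\<lambda>\<omega>. u0 v + (\<Sum>k<n. p (v - Z k \<omega>))) \<in> borel_measurable M" by measurable
  then show ?thesis by (simp add: U_eq cong: measurable_cong)
qed

lemma U_le: "\<omega> \<in> space M \<Longrightarrow> U n \<omega> v \<le> real n + 1"
proof -
  assume \<omega>: "\<omega> \<in> space M"
  have "U n \<omega> v = tally n (indicator {v}) \<omega>"
    using \<omega> finite_support_U[OF \<omega>, of n]
    by (subst tally_eq_sum[where F = "insert v {v. U n \<omega> v \<noteq> 0}"]) (auto simp: indicator_def if_distrib sum.If_cases)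
  also have "\<dots> \<le> real n + 1" using norm_tally_le[of "indicator {v} :: _ \<Rightarrow> real" 1 n \<omega>] by (simp add: indicator_def)
  finally show ?thesis .
qed

lemma U_integrable [simp]: "integrable M (\<lambda>\<omega>. U n \<omega> v)" "integrable M (\<lambda>\<omega>. U n \<omega> w * U n \<omega> v)"
proof -
  show "integrable M (\<lambda>\<omega>. U n \<omega> v)"
    using U_nonneg U_le by (intro integrable_const_bound[of _ "real n + 1"]) auto
  show "integrable M (\<lambda>\<omega>. U n \<omega> w * U n \<omega> v)"
    using U_nonneg U_le by (intro integrable_const_bound[of _ "(real n + 1) * (real n + 1)"]) (auto intro!: mult_mono)
qed

lemma draw_measurable [measurable]: "{\<omega> \<in> space M. Z n \<omega> = v} \<in> sets M"
  using measurable_sets[OF color, of "{v}" n] by (simp add: vimage_def Int_def conj_commute)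

lemma history_subalgebra: "sigma_finite_subalgebra M (urn_history M U n)"
proof -
  let ?G = "{{\<omega> \<in> space M. U k \<omega> v \<in> A} | k v A. k \<le> n \<and> A \<in> sets borel}"
  have "?G \<subseteq> sets M" by auto
  moreover have "?G \<subseteq> Pow (space M)" by blast
  ultimately have "subalgebra M (urn_history M U n)"
    using sets.sigma_sets_subset[of ?G M]
    unfolding subalgebra_def urn_history_def by (simp add: space_measure_of sets_measure_of)
  then have "finite_measure_subalgebra M (urn_history M U n)" by unfold_locales
  then show ?thesis by (simp add: finite_measure_subalgebra.axioms finite_measure_subalgebra_is_sigma_finite)
qed

lemma U_measurable_history: "(\<lambda>\<omega>. U n \<omega> v) \<in> borel_measurable (urn_history M U n)"
proof (rule measurableI)
  fix A :: "real set" assume "A \<in> sets borel"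
  then have "{\<omega> \<in> space M. U n \<omega> v \<in> A} \<in> sets (urn_history M U n)"
    unfolding urn_history_def by (intro in_measure_of) blast+
  moreover have "space (urn_history M U n) = space M"
    unfolding urn_history_def by (rule space_measure_of) blast
  ultimately show "(\<lambda>\<omega>. U n \<omega> v) -` A \<inter> space (urn_history M U n) \<in> sets (urn_history M U n)"
    by (simp add: vimage_def Int_def conj_commute)
qed simp

text \<open>The only place where the conditional law of the draws enters.\<close>

lemma expectation_draw:
  fixes Y :: "'a \<Rightarrow> real"
  assumes Y: "Y \<in> borel_measurable (urn_history M U n)" "\<And>\<omega>. \<omega> \<in> space M \<Longrightarrow> \<bar>Y \<omega>\<bar> \<le> C"
  shows "(\<integral>\<omega>. Y \<omega> * indicator {\<omega> \<in> space M. Z n \<omega> = v} \<omega> \<partial>M) = (\<integral>\<omega>. Y \<omega> * U n \<omega> v \<partial>M) / (real n + 1)"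
proof -
  interpret S: sigma_finite_subalgebra M "urn_history M U n" by (rule history_subalgebra)
  let ?I = "indicator {\<omega> \<in> space M. Z n \<omega> = v} :: 'a \<Rightarrow> real"
  have Ym [measurable]: "Y \<in> borel_measurable M" by (rule measurable_from_subalg[OF S.subalg Y(1)])
  have int: "integrable M (\<lambda>\<omega>. Y \<omega> * ?I \<omega>)"
  proof (rule integrable_const_bound[of _ "\<bar>C\<bar>"])
    show "AE \<omega> in M. norm (Y \<omega> * ?I \<omega>) \<le> \<bar>C\<bar>"
      by (intro AE_I2) (auto simp: indicator_def intro: order_trans[OF Y(2)])
  qed simp
  have "(\<integral>\<omega>. Y \<omega> * ?I \<omega> \<partial>M) = (\<integral>\<omega>. Y \<omega> * real_cond_exp M (urn_history M U n) ?I \<omega> \<partial>M)"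
    by (rule S.real_cond_exp_intg(2)[symmetric, OF int Y(1)]) simp
  also have "\<dots> = (\<integral>\<omega>. Y \<omega> * (U n \<omega> v / (real n + 1)) \<partial>M)"
    using selection[of n v] by (intro integral_cong_AE) auto
  finally show ?thesis by simp
qed

text \<open>Colours that the \<open>n\<close>-th draw can have with positive probability lie in this finite set. It is
deterministic, which allows expectations to be exchanged with the sum over colours.\<close>

primrec reach :: "nat \<Rightarrow> (int ^ 'd) set" where
  "reach 0 = {v. u0 v \<noteq> 0}"
| "reach (Suc n) = reach n \<union> (\<Union>v\<in>reach n. (+) v ` B)"

lemma finite_reach: "finite (reach n)"
  by (induction n) (auto simp: init_finite finite_B)

lemma reach_mono: "k \<le> n \<Longrightarrow> reach k \<subseteq> reach n"
  by (rule lift_Suc_mono_le) auto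

lemma U_outside_reach:
  assumes \<omega>: "\<omega> \<in> space M" and Z: "\<And>k. k < n \<Longrightarrow> Z k \<omega> \<in> reach k" and v: "v \<notin> reach n"
  shows "U n \<omega> v = 0"
proof -
  have "u0 v = 0" using v reach_mono[of 0 n] by auto
  moreover have "p (v - Z k \<omega>) = 0" if "k < n" for k
  proof (rule p_outside)
    show "v - Z k \<omega> \<notin> B"
    proof
      assume "v - Z k \<omega> \<in> B"
      then have "Z k \<omega> + (v - Z k \<omega>) \<in> (+) (Z k \<omega>) ` B" by (rule imageI)
      then have "v \<in> reach (Suc k)" using Z[OF that] by auto
      then show False using v reach_mono[of "Suc k" n] that by auto
    qed
  qed
  ultimately show ?thesis by (simp add: U_eq[OF \<omega>])
qed

text \<open>A colour outside the set has no mass in the urn almost surely, provided the earlier draws stayed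
inside, and hence is drawn with probability \<open>0\<close>.\<close>

lemma AE_draw_in_reach: "AE \<omega> in M. Z n \<omega> \<in> reach n"
proof (induction n rule: less_induct)
  case (less n)
  have earlier: "AE \<omega> in M. \<forall>k\<in>{..<n}. Z k \<omega> \<in> reach k" using less by (intro AE_finite_allI) auto
  have U0: "AE \<omega> in M. U n \<omega> v = 0" if "v \<notin> reach n" for v
    using earlier AE_space
  proof eventually_elim
    case (elim \<omega>)
    then show ?case using that by (intro U_outside_reach) auto
  qed
  have "AE \<omega> in M. Z n \<omega> \<noteq> v" if "v \<notin> reach n" for v
  proof -
    have "measure M {\<omega> \<in> space M. Z n \<omega> = v} = (\<integral>\<omega>. 1 * indicator {\<omega> \<in> space M. Z n \<omega> = v} \<omega> \<partial>M)" by simp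
    also have "\<dots> = (\<integral>\<omega>. 1 * U n \<omega> v \<partial>M) / (real n + 1)" by (rule expectation_draw[of _ _ 1]) auto
    also have "(\<integral>\<omega>. 1 * U n \<omega> v \<partial>M) = 0" 
    proof -
      have "(\<integral>\<omega>. 1 * U n \<omega> v \<partial>M) = (\<integral>\<omega>. 0 \<partial>M)"
        using U0[OF that] by (intro integral_cong_AE) auto
      then show ?thesis by simp
    qed
    finally have "emeasure M {\<omega> \<in> space M. Z n \<omega> = v} = 0" by (simp add: emeasure_eq_measure)
    then show ?thesis by (intro AE_I[where N = "{\<omega> \<in> space M. Z n \<omega> = v}"]) auto
  qed
  then have "AE \<omega> in M. \<forall>v. v \<notin> reach n \<longrightarrow> Z n \<omega> \<noteq> v" by (subst AE_all_countable) auto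
  then show ?case by auto
qed

lemma AE_tally_eq:
  fixes f :: "int ^ 'd \<Rightarrow> 'e::real_vector"
  shows "AE \<omega> in M. tally n f \<omega> = (\<Sum>v\<in>reach n. U n \<omega> v *\<^sub>R f v)"
proof -
  have "AE \<omega> in M. \<forall>k. Z k \<omega> \<in> reach k" by (simp add: AE_all_countable AE_draw_in_reach)
  then show ?thesis using AE_space
  proof eventually_elim
    case (elim \<omega>)
    then show ?case by (intro tally_eq_sum finite_reach U_outside_reach) auto
  qed
qed

definition mean_average :: "nat \<Rightarrow> (int ^ 'd \<Rightarrow> 'e::{banach, second_countable_topology}) \<Rightarrow> 'e" where
  "mean_average n f = (\<integral>\<omega>. tally n f \<omega> \<partial>M) /\<^sub>R (real n + 1)"

lemma AE_norm_le:
  fixes f :: "int ^ 'd \<Rightarrow> 'e::real_normed_vector"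
  shows "AE \<omega> in M. norm (tally n f \<omega>) \<le> (\<Sum>v\<in>reach n. (real n + 1) * norm (f v))"
    "AE \<omega> in M. norm (f (Z n \<omega>)) \<le> (\<Sum>v\<in>reach n. norm (f v))"
proof -
  show "AE \<omega> in M. norm (tally n f \<omega>) \<le> (\<Sum>v\<in>reach n. (real n + 1) * norm (f v))"
    using AE_tally_eq[of n f] AE_space
  proof eventually_elim
    case (elim \<omega>)
    have "norm (tally n f \<omega>) = norm (\<Sum>v\<in>reach n. U n \<omega> v *\<^sub>R f v)" using elim(1) by simp
    also have "\<dots> \<le> (\<Sum>v\<in>reach n. (real n + 1) * norm (f v))"
      using U_nonneg[OF elim(2)] U_le[OF elim(2)] by (intro sum_norm_le) (auto intro!: mult_right_mono)
    finally show ?case .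
  qed
  show "AE \<omega> in M. norm (f (Z n \<omega>)) \<le> (\<Sum>v\<in>reach n. norm (f v))"
    using AE_draw_in_reach[of n]
  proof eventually_elim
    case (elim \<omega>)
    then show ?case by (intro member_le_sum finite_reach) auto
  qed
qed

lemma draw_function_measurable [measurable]: "(\<lambda>\<omega>. f (Z n \<omega>)) \<in> borel_measurable M"
  by (rule measurable_compose[OF color]) simp

lemma integrable_tally [simp]:
  fixes f :: "int ^ 'd \<Rightarrow> 'e::{banach, second_countable_topology}"
  shows "integrable M (tally n f)"
  by (rule integrable_const_bound[OF AE_norm_le(1)]) simp

lemma integrable_draw [simp]:
  fixes f :: "int ^ 'd \<Rightarrow> 'e::{banach, second_countable_topology}"
  shows "integrable M (\<lambda>\<omega>. f (Z n \<omega>))"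
  by (rule integrable_const_bound[OF AE_norm_le(2)]) simp

lemma AE_draw_eq:
  "AE \<omega> in M. g (Z n \<omega>) = (\<Sum>v\<in>reach n. indicator {\<omega> \<in> space M. Z n \<omega> = v} \<omega> *\<^sub>R (g v :: 'e::real_vector))"
  using AE_draw_in_reach[of n] AE_space
proof eventually_elim
  case (elim \<omega>)
  have "(\<Sum>v\<in>reach n. indicator {\<omega> \<in> space M. Z n \<omega> = v} \<omega> *\<^sub>R g v) = (\<Sum>v\<in>reach n. if v = Z n \<omega> then g v else 0)"
    using elim by (intro sum.cong) (auto simp: indicator_def)
  then show ?case using elim finite_reach by simp
qed

lemma integral_draw:
  fixes g :: "int ^ 'd \<Rightarrow> 'e::{banach, second_countable_topology}"
  shows "(\<integral>\<omega>. g (Z n \<omega>) \<partial>M) = mean_average n g"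
proof -
  let ?I = "\<lambda>v. indicator {\<omega> \<in> space M. Z n \<omega> = v} :: 'a \<Rightarrow> real"
  have I: "(\<integral>\<omega>. ?I v \<omega> \<partial>M) = (\<integral>\<omega>. U n \<omega> v \<partial>M) / (real n + 1)" for v
    using expectation_draw[of "\<lambda>_. 1" n 1 v] by simp
  have int: "integrable M (?I v)" for v by (simp add: emeasure_eq_measure)
  have "(\<integral>\<omega>. g (Z n \<omega>) \<partial>M) = (\<integral>\<omega>. (\<Sum>v\<in>reach n. ?I v \<omega> *\<^sub>R g v) \<partial>M)"
    using AE_draw_eq[of g n] by (intro integral_cong_AE) auto
  also have "\<dots> = (\<Sum>v\<in>reach n. ((\<integral>\<omega>. U n \<omega> v \<partial>M) / (real n + 1)) *\<^sub>R g v)"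
    using int by (simp only: Bochner_Integration.integral_sum integrable_scaleR_left integral_scaleR_left I)
  also have "\<dots> = (\<integral>\<omega>. (\<Sum>v\<in>reach n. U n \<omega> v *\<^sub>R g v) \<partial>M) /\<^sub>R (real n + 1)"
    by (simp add: scaleR_sum_right divide_inverse mult.commute)
  also have "(\<integral>\<omega>. (\<Sum>v\<in>reach n. U n \<omega> v *\<^sub>R g v) \<partial>M) = (\<integral>\<omega>. tally n g \<omega> \<partial>M)"
    by (rule integral_cong_AE[OF _ _ AE_tally_eq, symmetric]) auto
  finally show ?thesis by (simp add: mean_average_def)
qed

text \<open>The conditional mean of \<open>g(Z\<^sub>n)\<close> is \<open>T\<^sub>n(g)/(n+1)\<close> and \<open>T\<^sub>n(f)\<close> is known at time \<open>n\<close>. As almost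
surely only finitely many colours occur, it suffices to treat the indicators of single colours.\<close>

lemma integral_tally_times_draw:
  fixes f g :: "int ^ 'd \<Rightarrow> complex"
  shows "integrable M (\<lambda>\<omega>. tally n f \<omega> * g (Z n \<omega>))"
    "integrable M (\<lambda>\<omega>. tally n f \<omega> * tally n g \<omega>)"
    "(\<integral>\<omega>. tally n f \<omega> * g (Z n \<omega>) \<partial>M) = (\<integral>\<omega>. tally n f \<omega> * tally n g \<omega> \<partial>M) / (real n + 1)"
proof -
  let ?I = "\<lambda>v. indicator {\<omega> \<in> space M. Z n \<omega> = v} :: 'a \<Rightarrow> real"
  have I: "(\<integral>\<omega>. U n \<omega> w * ?I v \<omega> \<partial>M) = (\<integral>\<omega>. U n \<omega> w * U n \<omega> v \<partial>M) / (real n + 1)" for v w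
    using U_nonneg U_le by (intro expectation_draw[OF U_measurable_history, where C = "real n + 1"]) auto
  have int: "integrable M (\<lambda>\<omega>. U n \<omega> w * ?I v \<omega>)" for v w
    by (rule integrable_real_mult_indicator) auto
  have e1: "AE \<omega> in M. tally n f \<omega> * g (Z n \<omega>)
      = (\<Sum>w\<in>reach n. \<Sum>v\<in>reach n. (U n \<omega> w * ?I v \<omega>) *\<^sub>R (f w * g v))"
    using AE_tally_eq[of n f] AE_draw_eq[of g n]
  proof eventually_elim
    case (elim \<omega>)
    have "tally n f \<omega> * g (Z n \<omega>) = (\<Sum>w\<in>reach n. U n \<omega> w *\<^sub>R f w) * (\<Sum>v\<in>reach n. ?I v \<omega> *\<^sub>R g v)"
      using elim by simp
    then show ?case by (simp add: sum_product scaleR_conv_of_real mult_ac)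
  qed
  have e2: "AE \<omega> in M. tally n f \<omega> * tally n g \<omega>
      = (\<Sum>w\<in>reach n. \<Sum>v\<in>reach n. (U n \<omega> w * U n \<omega> v) *\<^sub>R (f w * g v))"
    using AE_tally_eq[of n f] AE_tally_eq[of n g]
  proof eventually_elim
    case (elim \<omega>)
    have "tally n f \<omega> * tally n g \<omega> = (\<Sum>w\<in>reach n. U n \<omega> w *\<^sub>R f w) * (\<Sum>v\<in>reach n. U n \<omega> v *\<^sub>R g v)"
      using elim by simp
    then show ?case by (simp add: sum_product scaleR_conv_of_real mult_ac)
  qed
  show "integrable M (\<lambda>\<omega>. tally n f \<omega> * g (Z n \<omega>))"
    by (subst integrable_cong_AE[OF _ _ e1]) (auto intro!: Bochner_Integration.integrable_sum integrable_scaleR_left int)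
  show "integrable M (\<lambda>\<omega>. tally n f \<omega> * tally n g \<omega>)"
    by (subst integrable_cong_AE[OF _ _ e2]) (auto intro!: Bochner_Integration.integrable_sum integrable_scaleR_left U_integrable)
  have "(\<integral>\<omega>. tally n f \<omega> * g (Z n \<omega>) \<partial>M)
      = (\<Sum>w\<in>reach n. \<Sum>v\<in>reach n. ((\<integral>\<omega>. U n \<omega> w * U n \<omega> v \<partial>M) / (real n + 1)) *\<^sub>R (f w * g v))"
    using int by (subst integral_cong_AE[OF _ _ e1])
      (auto simp only: Bochner_Integration.integral_sum Bochner_Integration.integrable_sum integrable_scaleR_left integral_scaleR_left I, measurable)
  also have "\<dots> = (\<integral>\<omega>. tally n f \<omega> * tally n g \<omega> \<partial>M) / (real n + 1)"
  proof -
    have "(\<integral>\<omega>. tally n f \<omega> * tally n g \<omega> \<partial>M)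
        = (\<Sum>w\<in>reach n. \<Sum>v\<in>reach n. (\<integral>\<omega>. U n \<omega> w * U n \<omega> v \<partial>M) *\<^sub>R (f w * g v))"
      by (subst integral_cong_AE[OF _ _ e2])
        (auto simp only: Bochner_Integration.integral_sum Bochner_Integration.integrable_sum integrable_scaleR_left integral_scaleR_left U_integrable, measurable)
    then show ?thesis by (simp add: sum_divide_distrib scaleR_conv_of_real)
  qed
  finally show "(\<integral>\<omega>. tally n f \<omega> * g (Z n \<omega>) \<partial>M) = (\<integral>\<omega>. tally n f \<omega> * tally n g \<omega> \<partial>M) / (real n + 1)" .
qed

text \<open>The mean measure of the urn evolves like a random walk that makes step \<open>n\<close> with probability
\<open>1/(n+2)\<close> and rests otherwise.\<close>

lemma mean_average_Suc:
  "mean_average (Suc n) f = mean_average n f + (mean_average n (step f) - mean_average n f) /\<^sub>R (real n + 2)"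
proof -
  have "(\<integral>\<omega>. tally (Suc n) f \<omega> \<partial>M) = (real n + 1) *\<^sub>R mean_average n f + mean_average n (step f)"
    by (simp add: tally_Suc integral_draw) (simp add: mean_average_def)
  moreover have "(real n + 2) *\<^sub>R (mean_average n f + (mean_average n (step f) - mean_average n f) /\<^sub>R (real n + 2))
      = (real n + 1) *\<^sub>R mean_average n f + mean_average n (step f)"
    by (simp add: scaleR_add_right) (simp add: scaleR_add_left scaleR_2)
  moreover have "real (Suc n) + 1 = real n + 2" by simp
  then have "(real n + 2) *\<^sub>R mean_average (Suc n) f = (\<integral>\<omega>. tally (Suc n) f \<omega> \<partial>M)"
    unfolding mean_average_def by (simp only:) simp
  ultimately have "(real n + 2) *\<^sub>R mean_average (Suc n) f
      = (real n + 2) *\<^sub>R (mean_average n f + (mean_average n (step f) - mean_average n f) /\<^sub>R (real n + 2))"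
    by (simp only:)
  then show ?thesis by (subst (asm) scaleR_cancel_left) auto
qed

lemma tally_linear:
  "tally n (\<lambda>v. f v + g v) \<omega> = tally n f \<omega> + tally n g \<omega>"
  "tally n (\<lambda>v. r *\<^sub>R f v) \<omega> = r *\<^sub>R tally n f \<omega>"
  by (simp_all add: tally_def step_def scaleR_add_right sum.distrib scaleR_sum_right mult.commute)

lemma tally_mult: "tally n (\<lambda>v. c * f v) \<omega> = c * tally n f \<omega>" for c :: "'e::real_algebra"
  by (simp add: tally_def step_def sum_distrib_left distrib_left)

lemma mean_average_linear:
  "mean_average n (\<lambda>v. f v + g v) = mean_average n f + mean_average n g"
  "mean_average n (\<lambda>v. r *\<^sub>R f v) = r *\<^sub>R mean_average n f"
  "mean_average n (\<lambda>_. c) = c"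
  by (simp_all add: mean_average_def tally_linear tally_const scaleR_add_right prob_space)

lemma mean_average_mult: "mean_average n (\<lambda>v. c * f v) = c * mean_average n f"
  for c :: "'e::{real_normed_field, banach, second_countable_topology}"
  by (simp add: mean_average_def tally_mult)

lemma norm_mean_average_le:
  assumes "\<And>v. norm (f v) \<le> C"
  shows "norm (mean_average n f) \<le> C"
proof -
  have "norm (\<integral>\<omega>. tally n f \<omega> \<partial>M) \<le> (\<integral>\<omega>. norm (tally n f \<omega>) \<partial>M)" by (rule integral_norm_bound)
  also have "\<dots> \<le> (\<integral>\<omega>. (real n + 1) * C \<partial>M)" using norm_tally_le[OF assms] by (intro integral_mono) auto
  finally show ?thesis by (simp add: mean_average_def prob_space field_simps)
qed

lemma mean_average_eigenfunction:
  fixes f :: "int ^ 'd \<Rightarrow> complex"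
  assumes "\<And>v. step f v = \<phi> * f v"
  shows "mean_average n f = mean_average 0 f * (\<Prod>j<n. 1 + (\<phi> - 1) / of_nat (j + 2))"
proof (induction n)
  case (Suc n)
  have "step f = (\<lambda>v. \<phi> * f v)" using assms by auto
  then have "mean_average (Suc n) f = mean_average n f * (1 + (\<phi> - 1) / of_nat (n + 2))"
    by (simp add: mean_average_Suc mean_average_mult scaleR_conv_of_real divide_inverse algebra_simps)
  then show ?case by (simp add: Suc)
qed simp

lemma average_variance:
  fixes f :: "int ^ 'd \<Rightarrow> complex"
  shows "(\<integral>\<omega>. (norm (tally n f \<omega> /\<^sub>R (real n + 1) - mean_average n f))\<^sup>2 \<partial>M)
    = (\<integral>\<omega>. (norm (tally n f \<omega>))\<^sup>2 \<partial>M) / (real n + 1)\<^sup>2 - (norm (mean_average n f))\<^sup>2"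
    and "integrable M (\<lambda>\<omega>. (norm (tally n f \<omega> /\<^sub>R (real n + 1) - mean_average n f))\<^sup>2)"
    and "integrable M (\<lambda>\<omega>. (norm (tally n f \<omega>))\<^sup>2)"
proof -
  let ?T = "\<lambda>\<omega>. tally n f \<omega>" and ?m = "mean_average n f"
  let ?b = "\<Sum>v\<in>reach n. (real n + 1) * norm (f v)"
  show i2: "integrable M (\<lambda>\<omega>. (norm (?T \<omega>))\<^sup>2)"
  proof (rule integrable_const_bound)
    show "AE \<omega> in M. norm ((norm (?T \<omega>))\<^sup>2) \<le> ?b\<^sup>2"
      using AE_norm_le(1)[of n f] by eventually_elim (simp add: power_mono)
  qed measurable
  have pt: "(norm (?T \<omega> /\<^sub>R (real n + 1) - ?m))\<^sup>2
      = (norm (?T \<omega>))\<^sup>2 / (real n + 1)\<^sup>2 - 2 * Re (?T \<omega> * cnj ?m) / (real n + 1) + (norm ?m)\<^sup>2" for \<omega>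
  proof -
    have "(norm (x - ?m))\<^sup>2 = (norm x)\<^sup>2 - 2 * Re (x * cnj ?m) + (norm ?m)\<^sup>2" for x
      unfolding cmod_power2 by (simp add: power2_eq_square algebra_simps)
    note this[of "?T \<omega> /\<^sub>R (real n + 1)"]
    moreover have "Re ((?T \<omega> /\<^sub>R (real n + 1)) * cnj ?m) = Re (?T \<omega> * cnj ?m) / (real n + 1)"
      by (simp add: divide_inverse algebra_simps)
    moreover have "(norm (?T \<omega> /\<^sub>R (real n + 1)))\<^sup>2 = (norm (?T \<omega>))\<^sup>2 / (real n + 1)\<^sup>2"
      by (simp add: power_mult_distrib divide_inverse power_inverse)
    ultimately show ?thesis by (simp only: times_divide_eq_right)
  qed
  show "integrable M (\<lambda>\<omega>. (norm (?T \<omega> /\<^sub>R (real n + 1) - ?m))\<^sup>2)"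
    unfolding pt by (intro Bochner_Integration.integrable_add Bochner_Integration.integrable_diff integrable_divide_zero
      integrable_mult_right integrable_Re integrable_mult_left i2) auto
  have "(\<integral>\<omega>. Re (?T \<omega> * cnj ?m) \<partial>M) = Re ((\<integral>\<omega>. ?T \<omega> \<partial>M) * cnj ?m)"
    by (subst integral_Re) auto
  also have "(\<integral>\<omega>. ?T \<omega> \<partial>M) = (real n + 1) *\<^sub>R ?m" by (simp add: mean_average_def)
  finally have mid: "(\<integral>\<omega>. Re (?T \<omega> * cnj ?m) \<partial>M) = (real n + 1) * (norm ?m)\<^sup>2"
    unfolding cmod_power2 by (simp add: power2_eq_square algebra_simps)
  have iR: "integrable M (\<lambda>\<omega>. Re (?T \<omega> * cnj ?m))" by (intro integrable_Re integrable_mult_left) auto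
  have "(\<integral>\<omega>. (norm (?T \<omega> /\<^sub>R (real n + 1) - ?m))\<^sup>2 \<partial>M)
      = (\<integral>\<omega>. (norm (?T \<omega>))\<^sup>2 \<partial>M) / (real n + 1)\<^sup>2 - 2 * (\<integral>\<omega>. Re (?T \<omega> * cnj ?m) \<partial>M) / (real n + 1) + (norm ?m)\<^sup>2"
    unfolding pt using i2 iR by (simp add: prob_space del: times_complex.simps)
  then show "(\<integral>\<omega>. (norm (?T \<omega> /\<^sub>R (real n + 1) - ?m))\<^sup>2 \<partial>M)
    = (\<integral>\<omega>. (norm (?T \<omega>))\<^sup>2 \<partial>M) / (real n + 1)\<^sup>2 - (norm ?m)\<^sup>2"
    unfolding mid by simp
qed

text \<open>Expanding \<open>\<bar>T\<^sub>n + \<phi> f(Z\<^sub>n)\<bar>\<^sup>2\<close> gives recursions for \<open>E\<bar>T\<^sub>n\<bar>\<^sup>2\<close> and \<open>\<bar>E T\<^sub>n\<bar>\<^sup>2\<close> with the same leading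
factor, so that the variance is driven only by the defect \<open>1 - \<bar>m\<^sub>n\<bar>\<^sup>2\<close> of the mean \<open>m\<^sub>n\<close> of \<open>T\<^sub>n/(n+1)\<close>. After
division by \<open>(n+1)\<^sup>2\<close> the growth factor \<open>(n+1)(n+3)/(n+2)\<^sup>2\<close> is below \<open>1\<close> and can be dropped.\<close>

lemma average_variance_le:
  fixes f :: "int ^ 'd \<Rightarrow> complex"
  assumes eigen: "\<And>v. step f v = \<phi> * f v" and unit: "\<And>v. norm (f v) = 1"
  shows "(\<integral>\<omega>. (norm (tally n f \<omega> /\<^sub>R (real n + 1) - mean_average n f))\<^sup>2 \<partial>M)
    \<le> (\<Sum>k<n. (1 - (norm (mean_average k f))\<^sup>2) / (real k + 2)\<^sup>2)"
proof -
  define A where "A n = (\<integral>\<omega>. (norm (tally n f \<omega>))\<^sup>2 \<partial>M)" for n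
  define \<beta> where "\<beta> n = (norm (mean_average n f))\<^sup>2" for n
  define V where "V n = A n / (real n + 1)\<^sup>2 - \<beta> n" for n
  have V: "V n = (\<integral>\<omega>. (norm (tally n f \<omega> /\<^sub>R (real n + 1) - mean_average n f))\<^sup>2 \<partial>M)" for n
    by (simp add: V_def A_def \<beta>_def average_variance(1))
  have V_nonneg: "V n \<ge> 0" for n unfolding V by simp
  have \<phi>: "norm \<phi> \<le> 1"
    using norm_step_le[of f 1 0] unit by (simp add: eigen norm_mult)
  have \<beta>: "\<beta> n \<le> 1" for n
    using norm_mean_average_le[of f 1 n] unit by (simp add: \<beta>_def power_le_one)
  have A_Suc: "A (Suc n) = A n * (1 + 2 * Re \<phi> / (real n + 1)) + (norm \<phi>)\<^sup>2" for n
  proof -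
    have pt: "(norm (tally (Suc n) f \<omega>))\<^sup>2
        = (norm (tally n f \<omega>))\<^sup>2 + 2 * Re (cnj \<phi> * (tally n f \<omega> * cnj (f (Z n \<omega>)))) + (norm \<phi>)\<^sup>2" for \<omega>
    proof -
      have "(norm (x + y))\<^sup>2 = (norm x)\<^sup>2 + 2 * Re (x * cnj y) + (norm y)\<^sup>2" for x y :: complex
        unfolding cmod_power2 by (simp add: power2_eq_square algebra_simps)
      from this[of "tally n f \<omega>" "\<phi> * f (Z n \<omega>)"] show ?thesis
        by (simp add: tally_Suc eigen norm_mult unit mult_ac)
    qed
    have i: "integrable M (\<lambda>\<omega>. tally n f \<omega> * cnj (f (Z n \<omega>)))"
      by (rule integral_tally_times_draw(1)[where g = "\<lambda>v. cnj (f v)"])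
    have "(\<integral>\<omega>. tally n f \<omega> * cnj (f (Z n \<omega>)) \<partial>M) = (\<integral>\<omega>. tally n f \<omega> * tally n (\<lambda>v. cnj (f v)) \<omega> \<partial>M) / (real n + 1)"
      by (rule integral_tally_times_draw(3)[where g = "\<lambda>v. cnj (f v)"])
    moreover have "tally n (\<lambda>v. cnj (f v)) \<omega> = cnj (tally n f \<omega>)" for \<omega>
      by (simp add: tally_def step_def)
    moreover have "(\<integral>\<omega>. tally n f \<omega> * cnj (tally n f \<omega>) \<partial>M) = of_real (A n)"
      unfolding A_def integral_complex_of_real[symmetric] by (simp only: complex_norm_square)
    ultimately have cross: "(\<integral>\<omega>. tally n f \<omega> * cnj (f (Z n \<omega>)) \<partial>M) = of_real (A n / (real n + 1))"
      by simp
    have iR: "integrable M (\<lambda>\<omega>. Re (cnj \<phi> * (tally n f \<omega> * cnj (f (Z n \<omega>)))))"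
      by (intro integrable_Re integrable_mult_right i)
    have "(\<integral>\<omega>. Re (cnj \<phi> * (tally n f \<omega> * cnj (f (Z n \<omega>)))) \<partial>M)
        = Re (cnj \<phi> * (\<integral>\<omega>. tally n f \<omega> * cnj (f (Z n \<omega>)) \<partial>M))"
      using i by (subst integral_Re) (auto simp del: complex_cnj_mult)
    also have "\<dots> = Re \<phi> * (A n / (real n + 1))" unfolding cross by simp
    finally have R: "(\<integral>\<omega>. Re (cnj \<phi> * (tally n f \<omega> * cnj (f (Z n \<omega>)))) \<partial>M) = Re \<phi> * (A n / (real n + 1))" .
    have "A (Suc n) = A n + 2 * (Re \<phi> * (A n / (real n + 1))) + (norm \<phi>)\<^sup>2"
      unfolding A_def pt R[symmetric, unfolded A_def] using average_variance(3)[of n f] iR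
      by (simp add: prob_space del: times_complex.simps)
    then show ?thesis by (simp add: algebra_simps)
  qed
  have \<beta>_Suc: "(real n + 2)\<^sup>2 * \<beta> (Suc n) = \<beta> n * ((real n + 1)\<^sup>2 + 2 * (real n + 1) * Re \<phi> + (norm \<phi>)\<^sup>2)" for n
  proof -
    have "step f = (\<lambda>v. \<phi> * f v)" using eigen by auto
    then have "(real n + 2) *\<^sub>R mean_average (Suc n) f = mean_average n f * (of_real (real n + 1) + \<phi>)"
      by (simp add: mean_average_Suc mean_average_mult scaleR_add_right) (simp add: scaleR_conv_of_real algebra_simps)
    then have "(norm ((real n + 2) *\<^sub>R mean_average (Suc n) f))\<^sup>2 = (norm (mean_average n f))\<^sup>2 * (norm (of_real (real n + 1) + \<phi>))\<^sup>2"
      by (simp add: norm_mult power_mult_distrib)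
    moreover have "(norm (of_real (real n + 1) + \<phi>))\<^sup>2 = (real n + 1)\<^sup>2 + 2 * (real n + 1) * Re \<phi> + (norm \<phi>)\<^sup>2"
      unfolding cmod_power2 by (simp add: power2_eq_square algebra_simps)
    ultimately show ?thesis by (simp add: \<beta>_def power_mult_distrib)
  qed
  have V_Suc: "V (Suc n) \<le> V n + (1 - \<beta> n) / (real n + 2)\<^sup>2" for n
  proof -
    let ?a = "real n + 1"
    have pos: "?a > 0" by simp
    have "(real n + 2)\<^sup>2 * V (Suc n) = A (Suc n) - (real n + 2)\<^sup>2 * \<beta> (Suc n)"
      by (simp add: V_def field_simps)
    also have "\<dots> = (A n - ?a\<^sup>2 * \<beta> n) * (1 + 2 * Re \<phi> / ?a) + (norm \<phi>)\<^sup>2 * (1 - \<beta> n)"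
      unfolding A_Suc \<beta>_Suc using pos by (simp add: field_simps power2_eq_square)
    also have "A n - ?a\<^sup>2 * \<beta> n = ?a\<^sup>2 * V n" using pos by (simp add: V_def field_simps)
    also have "?a\<^sup>2 * V n * (1 + 2 * Re \<phi> / ?a) + (norm \<phi>)\<^sup>2 * (1 - \<beta> n) \<le> ?a\<^sup>2 * V n * (1 + 2 * 1 / ?a) + 1 * (1 - \<beta> n)"
    proof (intro add_mono mult_left_mono mult_right_mono divide_right_mono)
      show "Re \<phi> \<le> 1" using complex_Re_le_cmod[of \<phi>] \<phi> by linarith
      show "(norm \<phi>)\<^sup>2 \<le> 1" using \<phi> by (simp add: power_le_one)
    qed (use V_nonneg[of n] \<beta>[of n] in auto)
    also have "?a\<^sup>2 * V n * (1 + 2 * 1 / ?a) = V n * (?a * (?a + 2))" using pos by (simp add: field_simps power2_eq_square)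
    \<comment> \<open>\<open>(n+1)(n+3) \<le> (n+2)\<^sup>2\<close>\<close>
    also have "\<dots> \<le> V n * (real n + 2)\<^sup>2"
      using V_nonneg[of n] by (intro mult_left_mono) (auto simp: power2_eq_square algebra_simps)
    finally have "(real n + 2)\<^sup>2 * V (Suc n) \<le> (real n + 2)\<^sup>2 * (V n + (1 - \<beta> n) / (real n + 2)\<^sup>2)"
      by (simp add: distrib_left mult.commute)
    then show ?thesis by (simp add: mult_le_cancel_left_pos)
  qed
  have "V 0 = 0"
  proof -
    have "tally 0 f \<omega> = (\<Sum>v | u0 v \<noteq> 0. u0 v *\<^sub>R f v)" for \<omega> by (simp add: tally_def)
    then show ?thesis by (simp add: V_def A_def \<beta>_def mean_average_def prob_space)
  qed
  then have "V n \<le> (\<Sum>k<n. (1 - \<beta> k) / (real k + 2)\<^sup>2)"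
    using V_Suc by (induction n) (auto intro: order_trans add_right_mono)
  then show ?thesis by (simp add: V \<beta>_def)
qed

end

section \<open>Limits of the linear statistics\<close>

context finite_step_urn begin

definition step_char :: "real ^ 'd \<Rightarrow> complex" where
  "step_char \<theta> = (\<Sum>u\<in>B. p u *\<^sub>R cis (\<theta> \<bullet> real_vec u))"

definition step_mean :: "real ^ 'd" where
  "step_mean = (\<Sum>u\<in>B. p u *\<^sub>R real_vec u)"

lemma step_cis: "step (\<lambda>v. cis (\<theta> \<bullet> real_vec v)) v = step_char \<theta> * cis (\<theta> \<bullet> real_vec v)"
  unfolding step_def step_char_def sum_distrib_right
  by (intro sum.cong) (auto simp: real_vec_add inner_add_right mult.commute simp flip: cis_mult)

lemma norm_step_char_le: "norm (step_char \<theta>) \<le> 1"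
  using norm_step_le[of "\<lambda>v. cis (\<theta> \<bullet> real_vec v)" 1 0] by (simp add: step_cis norm_mult)

lemma mean_average_0: "mean_average 0 f = (\<Sum>v | u0 v \<noteq> 0. u0 v *\<^sub>R f v)"
proof -
  have "tally 0 f \<omega> = (\<Sum>v | u0 v \<noteq> 0. u0 v *\<^sub>R f v)" for \<omega> by (simp add: tally_def)
  then show ?thesis by (simp add: mean_average_def prob_space)
qed

text \<open>Continuity at \<open>0\<close> of the characteristic function of a finitely supported distribution.\<close>

lemma scaled_cis_tendsto:
  fixes s :: "real ^ 'd"
  assumes "finite F" "(\<Sum>v\<in>F. w v) = 1"
  shows "(\<lambda>n. \<Sum>v\<in>F. w v *\<^sub>R cis ((s /\<^sub>R sqrt (ln (real n))) \<bullet> real_vec v)) \<longlonglongrightarrow> 1"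
proof -
  have "(\<lambda>n. inverse (sqrt (ln (real n)))) \<longlonglongrightarrow> 0"
    by (intro tendsto_inverse_0_at_top filterlim_compose[OF sqrt_at_top ln_real_at_top])
  then have "(\<lambda>n. inverse (sqrt (ln (real n))) * (s \<bullet> real_vec v)) \<longlonglongrightarrow> 0" for v
    by (rule tendsto_mult_left_zero)
  then have cis0: "(\<lambda>n. cis ((s /\<^sub>R sqrt (ln (real n))) \<bullet> real_vec v)) \<longlonglongrightarrow> cis 0" for v
    by (intro tendsto_cis) simp
  have "(\<lambda>n. \<Sum>v\<in>F. w v *\<^sub>R cis ((s /\<^sub>R sqrt (ln (real n))) \<bullet> real_vec v)) \<longlonglongrightarrow> (\<Sum>v\<in>F. w v *\<^sub>R cis 0)"
    by (intro tendsto_sum tendsto_scaleR tendsto_const cis0)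
  also have "(\<Sum>v\<in>F. w v *\<^sub>R cis 0) = complex_of_real (\<Sum>v\<in>F. w v)" by (simp add: scaleR_conv_of_real)
  finally show ?thesis using assms by simp
qed

text \<open>Under the scaling by \<open>1/\<surd>(ln n)\<close> each increment contributes its first and second order term, and the
harmonic sum multiplies these by \<open>ln n\<close>. The first order term is removed by the centring.\<close>

lemma mean_character_limit:
  fixes s :: "real ^ 'd"
  defines "\<theta> \<equiv> \<lambda>n. s /\<^sub>R sqrt (ln (real n))"
  shows "(\<lambda>n. cis (- (ln (real n) * (\<theta> n \<bullet> step_mean))) * mean_average n (\<lambda>v. cis (\<theta> n \<bullet> real_vec v)))
    \<longlonglongrightarrow> of_real (exp (- (\<Sum>u\<in>B. p u * (s \<bullet> real_vec u)\<^sup>2) / 2))"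
proof -
  let ?c = "\<Sum>u\<in>B. p u *\<^sub>R (- complex_of_real ((s \<bullet> real_vec u)\<^sup>2 / 2))"
  have "(\<lambda>n. \<Sum>u\<in>B. p u *\<^sub>R (of_real (ln (real n)) * (cis ((s \<bullet> real_vec u) / sqrt (ln (real n))) - 1
      - \<i> * of_real ((s \<bullet> real_vec u) / sqrt (ln (real n)))))) \<longlonglongrightarrow> ?c"
    by (intro tendsto_sum tendsto_scaleR tendsto_const cis_second_order_limit ln_real_at_top)
  moreover have "(\<Sum>u\<in>B. p u *\<^sub>R (of_real (ln (real n)) * (cis ((s \<bullet> real_vec u) / sqrt (ln (real n))) - 1
      - \<i> * of_real ((s \<bullet> real_vec u) / sqrt (ln (real n))))))
      = of_real (ln (real n)) * (step_char (\<theta> n) - 1 - \<i> * of_real (\<theta> n \<bullet> step_mean))" for n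
  proof -
    have "\<theta> n \<bullet> step_mean = (\<Sum>u\<in>B. p u * (\<theta> n \<bullet> real_vec u))"
      by (simp add: step_mean_def inner_sum_right)
    then have "\<i> * of_real (\<theta> n \<bullet> step_mean) = (\<Sum>u\<in>B. p u *\<^sub>R (\<i> * of_real (\<theta> n \<bullet> real_vec u)))"
      by (simp add: sum_distrib_left scaleR_conv_of_real mult_ac)
    moreover have "1 = (\<Sum>u\<in>B. p u *\<^sub>R (1::complex))"
      by (simp add: scaleR_conv_of_real p_sum flip: of_real_sum)
    ultimately have "of_real (ln (real n)) * (step_char (\<theta> n) - 1 - \<i> * of_real (\<theta> n \<bullet> step_mean))
      = of_real (ln (real n)) * ((\<Sum>u\<in>B. p u *\<^sub>R cis (\<theta> n \<bullet> real_vec u)) - (\<Sum>u\<in>B. p u *\<^sub>R 1)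
        - (\<Sum>u\<in>B. p u *\<^sub>R (\<i> * of_real (\<theta> n \<bullet> real_vec u))))"
      by (simp only: step_char_def)
    also have "\<dots> = (\<Sum>u\<in>B. p u *\<^sub>R (of_real (ln (real n)) * (cis (\<theta> n \<bullet> real_vec u) - 1 - \<i> * of_real (\<theta> n \<bullet> real_vec u))))"
      by (simp add: sum_distrib_left scaleR_diff_right right_diff_distrib flip: sum_subtractf)
    moreover have "\<theta> n \<bullet> real_vec u = (s \<bullet> real_vec u) / sqrt (ln (real n))" for u
      by (simp add: \<theta>_def divide_inverse mult.commute)
    ultimately show ?thesis by (simp only:)
  qed
  ultimately have expansion: "(\<lambda>n. of_real (ln (real n)) * (step_char (\<theta> n) - 1 - \<i> * of_real (\<theta> n \<bullet> step_mean))) \<longlonglongrightarrow> ?c"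
    by (simp only:)
  have to1: "(\<lambda>n. step_char (\<theta> n)) \<longlonglongrightarrow> 1"
    unfolding step_char_def \<theta>_def by (rule scaled_cis_tendsto[OF finite_B p_sum])
  have "(\<lambda>n. mean_average 0 (\<lambda>v. cis (\<theta> n \<bullet> real_vec v))) \<longlonglongrightarrow> 1"
    unfolding mean_average_0 \<theta>_def by (rule scaled_cis_tendsto[OF init_finite init_sum])
  from tendsto_mult[OF this mean_product_limit[OF norm_step_char_le to1 expansion]]
  have "(\<lambda>n. cis (- (ln (real n) * (\<theta> n \<bullet> step_mean))) * mean_average n (\<lambda>v. cis (\<theta> n \<bullet> real_vec v))) \<longlonglongrightarrow> exp ?c"
    by (subst mean_average_eigenfunction[OF step_cis]) (simp add: mult_ac)
  moreover have "?c = of_real (- (\<Sum>u\<in>B. p u * (s \<bullet> real_vec u)\<^sup>2) / 2)"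
    by (simp add: scaleR_conv_of_real sum_divide_distrib sum_negf)
  ultimately show ?thesis by (simp only: exp_of_real)
qed

text \<open>Tannery's theorem applied to the variance bound: its terms are dominated by \<open>1/(k+2)\<^sup>2\<close>, and each
tends to \<open>0\<close> because at a fixed time the mean at a character depends continuously on the frequency.\<close>

lemma character_deviation_limit:
  fixes s :: "real ^ 'd"
  defines "ch \<equiv> \<lambda>n v. cis ((s /\<^sub>R sqrt (ln (real n))) \<bullet> real_vec v)"
  shows "(\<lambda>n. \<integral>\<omega>. norm (tally n (ch n) \<omega> /\<^sub>R (real n + 1) - mean_average n (ch n)) \<partial>M) \<longlonglongrightarrow> 0"
proof -
  \<comment> \<open>the finite sums in the variance bound as series, with terms beyond \<open>n\<close> set to \<open>0\<close>\<close>
  define a where "a k n = (if k < n then (1 - (norm (mean_average k (ch n)))\<^sup>2) / (real k + 2)\<^sup>2 else 0)" for k n :: nat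
  have eigen: "step (ch n) v = step_char (s /\<^sub>R sqrt (ln (real n))) * ch n v" for n v
    unfolding ch_def by (rule step_cis)
  have unit: "norm (ch n v) = 1" for n v by (simp add: ch_def)
  have lim: "(\<lambda>n. mean_average k (ch n)) \<longlonglongrightarrow> 1" for k
  proof -
    have "(\<lambda>n. mean_average 0 (ch n) * (\<Prod>j<k. 1 + (step_char (s /\<^sub>R sqrt (ln (real n))) - 1) / of_nat (j + 2)))
        \<longlonglongrightarrow> 1 * (\<Prod>j<k. 1 + (1 - 1) / of_nat (j + 2))"
      unfolding mean_average_0 ch_def step_char_def
      by (intro tendsto_mult tendsto_prod tendsto_add tendsto_divide tendsto_diff tendsto_const
        scaled_cis_tendsto finite_B init_finite p_sum init_sum) (simp only: of_nat_eq_0_iff)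
    then show ?thesis by (simp only: mean_average_eigenfunction[OF eigen, symmetric]) simp
  qed
  have "a k \<longlonglongrightarrow> 0" for k
  proof -
    have "(\<lambda>n. (1 - (norm (mean_average k (ch n)))\<^sup>2) / (real k + 2)\<^sup>2) \<longlonglongrightarrow> (1 - (norm (1::complex))\<^sup>2) / (real k + 2)\<^sup>2"
      by (intro tendsto_intros lim) simp
    then have "(\<lambda>n. (1 - (norm (mean_average k (ch n)))\<^sup>2) / (real k + 2)\<^sup>2) \<longlonglongrightarrow> 0" by simp
    moreover have "\<forall>\<^sub>F n in sequentially. a k n = (1 - (norm (mean_average k (ch n)))\<^sup>2) / (real k + 2)\<^sup>2"
      using eventually_gt_at_top[of k] by eventually_elim (simp add: a_def)
    ultimately show ?thesis by (simp add: tendsto_cong)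
  qed
  moreover have "norm (a k n) \<le> 1 / (real k + 2)\<^sup>2" for k n
  proof -
    have "norm (mean_average k (ch n)) \<le> 1" by (rule norm_mean_average_le) (simp add: unit)
    then show ?thesis by (simp add: a_def abs_divide divide_right_mono power_le_one)
  qed
  moreover have "summable (\<lambda>k. 1 / (real k + 2)\<^sup>2)"
  proof -
    have "summable (\<lambda>k. inverse (real (k + 2) ^ 2))"
      by (rule summable_ignore_initial_segment) (rule inverse_power_summable, simp)
    then show ?thesis by (simp add: inverse_eq_divide add.commute)
  qed
  ultimately have "(\<lambda>n. \<Sum>k. a k n) \<longlonglongrightarrow> (\<Sum>k. 0)"
    by (intro tannerys_theorem[THEN conjunct2, THEN conjunct2] always_eventually) auto
  moreover have "(\<Sum>k. a k n) = (\<Sum>k<n. (1 - (norm (mean_average k (ch n)))\<^sup>2) / (real k + 2)\<^sup>2)" for n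
    by (subst suminf_finite[of "{..<n}"]) (auto simp: a_def)
  ultimately have "(\<lambda>n. sqrt (\<Sum>k<n. (1 - (norm (mean_average k (ch n)))\<^sup>2) / (real k + 2)\<^sup>2)) \<longlonglongrightarrow> sqrt 0"
    by (intro tendsto_real_sqrt) simp
  then have sqrt0: "(\<lambda>n. sqrt (\<Sum>k<n. (1 - (norm (mean_average k (ch n)))\<^sup>2) / (real k + 2)\<^sup>2)) \<longlonglongrightarrow> 0" by simp
  show ?thesis
  proof (rule tendsto_sandwich[OF _ _ tendsto_const sqrt0])
    show "\<forall>\<^sub>F n in sequentially. (\<integral>\<omega>. norm (tally n (ch n) \<omega> /\<^sub>R (real n + 1) - mean_average n (ch n)) \<partial>M)
      \<le> sqrt (\<Sum>k<n. (1 - (norm (mean_average k (ch n)))\<^sup>2) / (real k + 2)\<^sup>2)"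
    proof (intro always_eventually allI)
      fix n
      have "(\<integral>\<omega>. norm (tally n (ch n) \<omega> /\<^sub>R (real n + 1) - mean_average n (ch n)) \<partial>M)
        \<le> sqrt (\<integral>\<omega>. (norm (tally n (ch n) \<omega> /\<^sub>R (real n + 1) - mean_average n (ch n)))\<^sup>2 \<partial>M)"
        by (intro integral_norm_le_sqrt average_variance(2)) simp
      also have "\<dots> \<le> sqrt (\<Sum>k<n. (1 - (norm (mean_average k (ch n)))\<^sup>2) / (real k + 2)\<^sup>2)"
        by (rule real_sqrt_le_mono[OF average_variance_le[OF eigen unit]])
      finally show "(\<integral>\<omega>. norm (tally n (ch n) \<omega> /\<^sub>R (real n + 1) - mean_average n (ch n)) \<partial>M)
        \<le> sqrt (\<Sum>k<n. (1 - (norm (mean_average k (ch n)))\<^sup>2) / (real k + 2)\<^sup>2)" .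
    qed
  qed simp
qed

lemma mean_average_linear_form:
  "mean_average n (\<lambda>v. s \<bullet> real_vec v)
    = mean_average 0 (\<lambda>v. s \<bullet> real_vec v) + (s \<bullet> step_mean) * (\<Sum>j<n. 1 / real (j + 2))"
proof (induction n)
  case (Suc n)
  have "step (\<lambda>v. s \<bullet> real_vec v) v = s \<bullet> real_vec v + s \<bullet> step_mean" for v
    by (simp add: step_def step_mean_def real_vec_add inner_add_right inner_sum_right distrib_left sum.distrib p_sum
        flip: sum_distrib_right)
  then have "step (\<lambda>v. s \<bullet> real_vec v) = (\<lambda>v. s \<bullet> real_vec v + s \<bullet> step_mean)" by auto
  then have "mean_average (Suc n) (\<lambda>v. s \<bullet> real_vec v) = mean_average n (\<lambda>v. s \<bullet> real_vec v) + (s \<bullet> step_mean) / (real n + 2)"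
    by (simp add: mean_average_Suc mean_average_linear divide_inverse mult.commute)
  then show ?case by (simp add: Suc distrib_left add_ac)
qed simp

text \<open>A step adds the second moment of the increment with weight \<open>1/(n+2)\<close> to the variance of a linear
form, minus a square.\<close>

lemma mean_average_variance_le:
  defines "W \<equiv> \<lambda>n s. mean_average n (\<lambda>v. (s \<bullet> real_vec v)\<^sup>2) - (mean_average n (\<lambda>v. s \<bullet> real_vec v))\<^sup>2"
  shows "W n s \<le> W 0 s + (\<Sum>u\<in>B. p u * (s \<bullet> real_vec u)\<^sup>2) * (\<Sum>j<n. 1 / real (j + 2))"
proof (induction n)
  case (Suc n)
  let ?l = "\<lambda>v. s \<bullet> real_vec v" and ?a = "s \<bullet> step_mean" and ?b = "\<Sum>u\<in>B. p u * (s \<bullet> real_vec u)\<^sup>2"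
  have a: "?a = (\<Sum>u\<in>B. p u * ?l u)" by (simp add: step_mean_def inner_sum_right)
  have "step (\<lambda>v. (?l v)\<^sup>2) v = (?l v)\<^sup>2 + ((2 * ?a) *\<^sub>R ?l v + ?b)" for v
  proof -
    have "step (\<lambda>v. (?l v)\<^sup>2) v = (\<Sum>u\<in>B. p u * (?l v)\<^sup>2 + 2 * ?l v * (p u * ?l u) + p u * (?l u)\<^sup>2)"
      unfolding step_def by (intro sum.cong) (auto simp: real_vec_add inner_add_right power2_eq_square algebra_simps)
    also have "\<dots> = (?l v)\<^sup>2 + 2 * ?l v * ?a + ?b"
      unfolding a by (simp add: sum.distrib p_sum flip: sum_distrib_left sum_distrib_right)
    finally show ?thesis by simp
  qed
  then have st: "step (\<lambda>v. (?l v)\<^sup>2) = (\<lambda>v. (?l v)\<^sup>2 + ((2 * ?a) *\<^sub>R ?l v + ?b))" by auto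
  define q e where "q = mean_average n (\<lambda>v. (?l v)\<^sup>2)" and "e = mean_average n ?l"
  have sq: "mean_average (Suc n) (\<lambda>v. (?l v)\<^sup>2) = q + (2 * ?a * e + ?b) / (real n + 2)"
    unfolding mean_average_Suc st mean_average_linear q_def e_def by (simp add: divide_inverse mult.commute)
  have l: "mean_average (Suc n) ?l = e + ?a / (real n + 2)"
    unfolding e_def mean_average_linear_form[of n] mean_average_linear_form[of "Suc n"] by (simp add: algebra_simps)
  have "W (Suc n) s = q - e\<^sup>2 + ?b / (real n + 2) - (?a / (real n + 2))\<^sup>2"
    unfolding W_def sq l by (simp add: power2_eq_square add_divide_distrib algebra_simps)
  also have "\<dots> \<le> W n s + ?b / (real n + 2)" by (simp add: W_def q_def e_def)
  finally show ?case using Suc by (simp add: distrib_left add.commute)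
qed simp

text \<open>The second moment about \<open>\<mu> ln n\<close> is the variance plus the squared distance of the mean from
\<open>\<mu> ln n\<close>. The variance is at most \<open>const \<cdot> ln n + O(1)\<close> and the distance is bounded, since the
harmonic sums are \<open>ln n + O(1)\<close>.\<close>

lemma second_moment_bounded:
  "\<exists>C. \<forall>n\<ge>2. mean_average n (\<lambda>v. (((s /\<^sub>R sqrt (ln (real n))) \<bullet> (real_vec v - ln (real n) *\<^sub>R step_mean)))\<^sup>2) \<le> C"
proof -
  let ?l = "\<lambda>v. s \<bullet> real_vec v" and ?a = "s \<bullet> step_mean" and ?b = "\<Sum>u\<in>B. p u * (s \<bullet> real_vec u)\<^sup>2"
  define h where "h n = (\<Sum>j<n. 1 / real (j + 2))" for n :: nat
  define m w where "m = mean_average 0 ?l" and "w = mean_average 0 (\<lambda>v. (?l v)\<^sup>2) - m\<^sup>2"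
  have "Bseq (\<lambda>n. h n - ln (real n))"
    using harmonic_tail_minus_ln unfolding h_def by (intro convergent_imp_Bseq convergentI)
  then obtain D where D: "D > 0" "\<And>n. \<bar>h n - ln (real n)\<bar> \<le> D" by (auto elim: BseqE)
  have b: "?b \<ge> 0" by (intro sum_nonneg mult_nonneg_nonneg p_nonneg) auto
  let ?C = "(\<bar>w\<bar> + ?b * D + (\<bar>m\<bar> + \<bar>?a\<bar> * D)\<^sup>2) / ln 2 + ?b"
  show ?thesis
  proof (intro exI[of _ ?C] allI impI)
    fix n :: nat assume n: "n \<ge> 2"
    define r where "r = ln (real n)"
    have r: "r \<ge> ln 2" "r > 0" using n by (auto simp: r_def)
    have ln2: "ln 2 > (0::real)" by simp
    have D': "\<bar>h n - r\<bar> \<le> D" unfolding r_def by (rule D(2))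
    define q e where "q = mean_average n (\<lambda>v. (?l v)\<^sup>2)" and "e = mean_average n ?l"
    have e: "e = m + ?a * h n" unfolding e_def m_def h_def by (rule mean_average_linear_form)
    have q: "q - e\<^sup>2 \<le> w + ?b * h n"
      unfolding q_def e_def w_def m_def h_def by (rule mean_average_variance_le)
    have sq: "(((s /\<^sub>R sqrt r) \<bullet> (real_vec v - r *\<^sub>R step_mean)))\<^sup>2 = (1 / r) *\<^sub>R ((?l v)\<^sup>2 + ((- 2 * r * ?a) *\<^sub>R ?l v + (r * ?a)\<^sup>2))" for v
    proof -
      have "(s /\<^sub>R sqrt r) \<bullet> (real_vec v - r *\<^sub>R step_mean) = (?l v - r * ?a) / sqrt r"
        by (simp add: inner_diff_right divide_inverse algebra_simps)
      then have "(((s /\<^sub>R sqrt r) \<bullet> (real_vec v - r *\<^sub>R step_mean)))\<^sup>2 = (?l v - r * ?a)\<^sup>2 / r"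
        using r by (simp add: power_divide)
      also have "\<dots> = (1 / r) *\<^sub>R ((?l v)\<^sup>2 + ((- 2 * r * ?a) *\<^sub>R ?l v + (r * ?a)\<^sup>2))"
        by (simp add: power2_eq_square divide_inverse algebra_simps)
      finally show ?thesis .
    qed
    have "mean_average n (\<lambda>v. (((s /\<^sub>R sqrt r) \<bullet> (real_vec v - r *\<^sub>R step_mean)))\<^sup>2)
        = (1 / r) * (q + (- 2 * r * ?a * e + (r * ?a)\<^sup>2))"
      unfolding sq mean_average_linear q_def e_def by simp
    \<comment> \<open>variance plus squared displacement of the mean\<close>
    also have "\<dots> = ((q - e\<^sup>2) + (e - r * ?a)\<^sup>2) / r" by (simp add: power2_eq_square divide_inverse algebra_simps)
    also have "e - r * ?a = m + ?a * (h n - r)" by (simp add: e algebra_simps)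
    also have "((q - e\<^sup>2) + (m + ?a * (h n - r))\<^sup>2) / r \<le> ((\<bar>w\<bar> + ?b * D + ?b * r) + (\<bar>m\<bar> + \<bar>?a\<bar> * D)\<^sup>2) / r"
    proof (intro divide_right_mono add_mono)
      have "?b * h n \<le> ?b * (D + r)" using D' b by (intro mult_left_mono) auto
      then show "q - e\<^sup>2 \<le> \<bar>w\<bar> + ?b * D + ?b * r" using q by (simp add: distrib_left)
      have "\<bar>m + ?a * (h n - r)\<bar> \<le> \<bar>m\<bar> + \<bar>?a\<bar> * \<bar>h n - r\<bar>"
        using abs_triangle_ineq[of m "?a * (h n - r)"] by (simp add: abs_mult)
      also have "\<dots> \<le> \<bar>m\<bar> + \<bar>?a\<bar> * D" using D' by (intro add_left_mono mult_left_mono) auto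
      finally have "\<bar>m + ?a * (h n - r)\<bar>\<^sup>2 \<le> (\<bar>m\<bar> + \<bar>?a\<bar> * D)\<^sup>2" by (intro power_mono) auto
      then show "(m + ?a * (h n - r))\<^sup>2 \<le> (\<bar>m\<bar> + \<bar>?a\<bar> * D)\<^sup>2" by simp
    qed (use r in auto)
    also have "\<dots> = (\<bar>w\<bar> + ?b * D + (\<bar>m\<bar> + \<bar>?a\<bar> * D)\<^sup>2) / r + ?b" using r by (simp add: field_simps)
    also have "\<dots> \<le> ?C" using r(1) b D(1) mult_pos_pos[OF r(2) ln2] by (intro add_right_mono divide_left_mono add_nonneg_nonneg mult_nonneg_nonneg) auto
    finally show "mean_average n (\<lambda>v. (((s /\<^sub>R sqrt (ln (real n))) \<bullet> (real_vec v - ln (real n) *\<^sub>R step_mean)))\<^sup>2) \<le> ?C"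
      by (simp add: r_def)
  qed
qed

end

section \<open>The centred and scaled urn measure\<close>

lemma integral_lattice_measure:
  fixes g :: "real ^ 'd::finite \<Rightarrow> 'e::{banach, second_countable_topology}"
  assumes w: "finite F" "\<And>v. v \<notin> F \<Longrightarrow> w v = 0" "\<And>v. w v \<ge> 0" and g: "g \<in> borel_measurable borel"
  shows "integrable (lattice_measure w) g"
    "(\<integral>x. g x \<partial>lattice_measure w) = (\<Sum>v\<in>F. w v *\<^sub>R g (real_vec v))"
proof -
  let ?f = "\<lambda>v. w v *\<^sub>R g (real_vec v)"
  have "(\<integral>\<^sup>+v. ennreal (norm (?f v)) \<partial>count_space UNIV) = (\<Sum>v\<in>F. ennreal (norm (?f v)))"
    using w by (intro nn_integral_count_space') auto
  also have "\<dots> < \<infinity>" by (simp add: less_top[symmetric])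
  finally have "integrable (count_space UNIV) ?f" by (simp add: integrable_iff_bounded)
  then show "integrable (lattice_measure w) g"
    unfolding lattice_measure_def using g w(3) by (subst integrable_distr_eq) (auto simp: integrable_density)
  have "(\<integral>x. g x \<partial>lattice_measure w) = (\<integral>v. ?f v \<partial>count_space UNIV)"
    unfolding lattice_measure_def using g w(3) by (subst integral_distr) (auto simp: integral_density)
  also have "\<dots> = (\<Sum>v | v \<in> UNIV \<and> ?f v \<noteq> 0. ?f v)"
    using w(2) by (intro lebesgue_integral_count_space_finite_support finite_subset[OF _ w(1)]) auto
  also have "\<dots> = (\<Sum>v\<in>F. ?f v)"
    using w by (intro sum.mono_neutral_left) auto
  finally show "(\<integral>x. g x \<partial>lattice_measure w) = (\<Sum>v\<in>F. ?f v)" .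
qed

lemma lattice_measure_prob:
  fixes w :: "int ^ 'd::finite \<Rightarrow> real"
  assumes w: "finite F" "\<And>v. v \<notin> F \<Longrightarrow> w v = 0" "\<And>v. w v \<ge> 0" "(\<Sum>v\<in>F. w v) = 1"
  shows "prob_space (lattice_measure w)"
proof
  have "emeasure (lattice_measure w) (space (lattice_measure w)) = (\<integral>\<^sup>+v. ennreal (w v) \<partial>count_space UNIV)"
    unfolding lattice_measure_def by (simp add: emeasure_distr emeasure_density)
  also have "\<dots> = (\<Sum>v\<in>F. ennreal (w v))" using w by (intro nn_integral_count_space') auto
  also have "\<dots> = 1" using w by simp
  finally show "emeasure (lattice_measure w) (space (lattice_measure w)) = 1" .
qed

text \<open>The inverse of the affine map \<open>a \<mapsto> \<surd>(ln n) a S + ln n m\<close>, so that images under the latter become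
preimages and the scaled measure a push-forward.\<close>

definition standardize :: "real ^ 'd \<Rightarrow> real ^ 'd ^ 'd \<Rightarrow> nat \<Rightarrow> real ^ 'd \<Rightarrow> real ^ 'd::finite" where
  "standardize m S n y = ((y - ln (real n) *\<^sub>R m) /\<^sub>R sqrt (ln (real n))) v* matrix_inv S"

lemma standardize_continuous: "continuous_on UNIV (standardize m S n)"
proof -
  have "continuous_on UNIV (\<lambda>y. transpose (matrix_inv S) *v ((y - ln (real n) *\<^sub>R m) /\<^sub>R sqrt (ln (real n))))"
    by (intro bounded_linear.continuous_on[OF matrix_vector_mul_bounded_linear] continuous_intros)
  then show ?thesis by (simp add: standardize_def[abs_def])
qed

lemma standardize_measurable [measurable]: "standardize m S n \<in> borel_measurable borel"
  by (rule borel_measurable_continuous_onI[OF standardize_continuous])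

text \<open>Characters and coordinates of the standardized point are those of the lattice point, at a rescaled
frequency.\<close>

lemma inner_standardize:
  "t \<bullet> standardize m S n y = ((matrix_inv S *v t) /\<^sub>R sqrt (ln (real n))) \<bullet> (y - ln (real n) *\<^sub>R m)"
  by (simp add: standardize_def inner_commute[of t] dot_lmul_matrix inner_commute[of "y - _"])

lemma invertible_matrix_inv:
  assumes "invertible S"
  shows "S ** matrix_inv S = mat 1" "matrix_inv S ** S = mat 1"
  using someI_ex[OF assms[unfolded invertible_def]] by (simp_all add: matrix_inv_def)

lemma scaled_urn_measure_eq_distr:
  assumes S: "invertible S" and n: "n \<ge> 2"
  shows "scaled_urn_measure m S U n \<omega> = distr (urn_measure U n \<omega>) borel (standardize m S n)"
proof -
  let ?T = "\<lambda>a. sqrt (ln (real n)) *\<^sub>R (a v* S) + ln (real n) *\<^sub>R m"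
  have L: "sqrt (ln (real n)) > 0" using n by simp
  have inv: "standardize m S n (?T a) = a" "?T (standardize m S n y) = y" for a y
    using L S by (simp_all add: standardize_def scaleR_vector_matrix_assoc vector_matrix_mul_assoc invertible_matrix_inv)
  have image: "?T ` A = standardize m S n -` A" for A
  proof
    show "standardize m S n -` A \<subseteq> ?T ` A"
    proof
      fix y assume "y \<in> standardize m S n -` A"
      then show "y \<in> ?T ` A" using inv(2)[of y] by (intro image_eqI[of _ _ "standardize m S n y"]) auto
    qed
  qed (auto simp: inv)
  let ?D = "distr (urn_measure U n \<omega>) borel (standardize m S n)"
  have u: "sets (urn_measure U n \<omega>) = sets borel" "space (urn_measure U n \<omega>) = UNIV"
    by (simp_all add: urn_measure_def lattice_measure_def)
  have "scaled_urn_measure m S U n \<omega> = measure_of UNIV (sets borel) (emeasure ?D)"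
    unfolding scaled_urn_measure_def
  proof (rule measure_of_eq)
    fix A :: "(real ^ 'a) set" assume "A \<in> sigma_sets UNIV (sets borel)"
    then have "A \<in> sets borel" using sets.sigma_sets_eq[of "borel :: (real ^ 'a) measure"] by simp
    then show "emeasure (urn_measure U n \<omega>) (?T ` A) = emeasure ?D A"
      by (subst emeasure_distr) (auto simp: image u cong: measurable_cong_sets)
  qed simp
  also have "\<dots> = ?D" using measure_of_of_measure[of ?D] by simp
  finally show ?thesis .
qed

context finite_step_urn begin

text \<open>This turns the theorem into a statement on linear statistics of the urn. It holds at every sample
point, so measurability of the integrals is inherited from the linear statistics.\<close>

lemma integral_scaled_urn_measure:
  fixes g :: "real ^ 'd \<Rightarrow> 'e::{banach, second_countable_topology}"
  assumes S: "invertible S" and n: "n \<ge> 2" and \<omega>: "\<omega> \<in> space M" and g: "g \<in> borel_measurable borel"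
  shows "integrable (scaled_urn_measure m S U n \<omega>) g"
    "(\<integral>x. g x \<partial>scaled_urn_measure m S U n \<omega>) = tally n (\<lambda>v. g (standardize m S n (real_vec v))) \<omega> /\<^sub>R (real n + 1)"
proof -
  let ?F = "{v. U n \<omega> v \<noteq> 0}" and ?w = "\<lambda>v. U n \<omega> v / (real n + 1)"
  have w: "finite ?F" "\<And>v. v \<notin> ?F \<Longrightarrow> ?w v = 0" "\<And>v. ?w v \<ge> 0"
    using finite_support_U[OF \<omega>] U_nonneg[OF \<omega>] by auto
  have u: "sets (urn_measure U n \<omega>) = sets borel" by (simp add: urn_measure_def lattice_measure_def)
  have st: "standardize m S n \<in> measurable (urn_measure U n \<omega>) borel"
    by (simp add: measurable_cong_sets[OF u refl])
  have gs: "(\<lambda>x. g (standardize m S n x)) \<in> borel_measurable borel" using g by measurable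
  note lat = integral_lattice_measure[OF w gs]
  show "integrable (scaled_urn_measure m S U n \<omega>) g"
    unfolding scaled_urn_measure_eq_distr[OF S n] using lat(1) by (subst integrable_distr_eq[OF st g]) (simp add: urn_measure_def)
  have "(\<integral>x. g x \<partial>scaled_urn_measure m S U n \<omega>) = (\<Sum>v\<in>?F. ?w v *\<^sub>R g (standardize m S n (real_vec v)))"
    unfolding scaled_urn_measure_eq_distr[OF S n] integral_distr[OF st g] using lat(2) by (simp add: urn_measure_def)
  also have "\<dots> = tally n (\<lambda>v. g (standardize m S n (real_vec v))) \<omega> /\<^sub>R (real n + 1)"
    by (subst tally_eq_sum[OF \<omega> w(1)]) (auto simp: scaleR_sum_right divide_inverse mult.commute)
  finally show "(\<integral>x. g x \<partial>scaled_urn_measure m S U n \<omega>)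
    = tally n (\<lambda>v. g (standardize m S n (real_vec v))) \<omega> /\<^sub>R (real n + 1)" .
qed

lemma scaled_urn_measure_prob:
  assumes S: "invertible S" and n: "n \<ge> 2" and \<omega>: "\<omega> \<in> space M"
  shows "scaled_urn_measure m S U n \<omega> \<in> prob_measures"
proof -
  let ?F = "{v. U n \<omega> v \<noteq> 0}" and ?w = "\<lambda>v. U n \<omega> v / (real n + 1)"
  have "(\<Sum>v\<in>?F. U n \<omega> v) = tally n (\<lambda>_. 1::real) \<omega>"
    by (subst tally_eq_sum[OF \<omega> finite_support_U[OF \<omega>]]) auto
  then have "(\<Sum>v\<in>?F. ?w v) = 1" by (simp add: tally_const flip: sum_divide_distrib)
  then have "prob_space (urn_measure U n \<omega>)"
    unfolding urn_measure_def using finite_support_U[OF \<omega>] U_nonneg[OF \<omega>]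
    by (intro lattice_measure_prob[of ?F]) auto
  then have "prob_space (distr (urn_measure U n \<omega>) borel (standardize m S n))"
    by (rule prob_space.prob_space_distr) (simp add: urn_measure_def lattice_measure_def)
  then show ?thesis by (simp add: prob_measures_def scaled_urn_measure_eq_distr[OF S n])
qed

end

section \<open>The increments and the limit theorem\<close>

context bounded_increment_walk begin

lemma X1_measurable [measurable]: "X 1 \<in> measurable N (count_space UNIV)"
  using indep by (auto simp: indep_vars_def)

lemma increment_event [measurable]: "{\<omega> \<in> space N. X (Suc 0) \<omega> = u} \<in> sets N"
  using measurable_sets[OF X1_measurable, of "{u}"] by (simp add: vimage_def Int_def conj_commute)

lemma AE_X1_in_B: "AE \<omega> in N. X 1 \<omega> \<in> B"
proof -
  have "AE \<omega> in N. X 1 \<omega> \<noteq> u" if "u \<notin> B" for u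
    using supp[OF that] by (intro AE_I[where N = "{\<omega> \<in> space N. X 1 \<omega> = u}"]) (auto simp: emeasure_eq_measure)
  then have "AE \<omega> in N. \<forall>u. u \<notin> B \<longrightarrow> X 1 \<omega> \<noteq> u" by (subst AE_all_countable) auto
  then show ?thesis by auto
qed

lemma integral_increment:
  fixes g :: "int ^ 'd \<Rightarrow> 'e::{banach, second_countable_topology}"
  shows "(\<integral>\<omega>. g (X 1 \<omega>) \<partial>N) = (\<Sum>u\<in>B. increment_pmf N X u *\<^sub>R g u)"
proof -
  let ?I = "\<lambda>u. indicator {\<omega> \<in> space N. X 1 \<omega> = u} :: 'b \<Rightarrow> real"
  have [measurable]: "(\<lambda>\<omega>. g (X (Suc 0) \<omega>)) \<in> borel_measurable N"
    using measurable_compose[OF X1_measurable, of g borel] by simp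
  have "AE \<omega> in N. g (X 1 \<omega>) = (\<Sum>u\<in>B. ?I u \<omega> *\<^sub>R g u)"
    using AE_X1_in_B AE_space
  proof eventually_elim
    case (elim \<omega>)
    have "(\<Sum>u\<in>B. ?I u \<omega> *\<^sub>R g u) = (\<Sum>u\<in>B. if u = X 1 \<omega> then g u else 0)"
      using elim by (intro sum.cong) (auto simp: indicator_def)
    then show ?case using elim B by simp
  qed
  then have "(\<integral>\<omega>. g (X 1 \<omega>) \<partial>N) = (\<integral>\<omega>. (\<Sum>u\<in>B. ?I u \<omega> *\<^sub>R g u) \<partial>N)"
    by (intro integral_cong_AE) auto
  also have "\<dots> = (\<Sum>u\<in>B. (\<integral>\<omega>. ?I u \<omega> \<partial>N) *\<^sub>R g u)"
  proof -
    have "integrable N (?I u)" for u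
      using increment_event[of u] by (simp add: emeasure_eq_measure)
    then show ?thesis
      by (simp only: Bochner_Integration.integral_sum integrable_scaleR_left integral_scaleR_left)
  qed
  finally show ?thesis by (simp add: increment_pmf_def)
qed

text \<open>The quadratic form of the matrix \<open>E[X\<^sub>1\<^sup>T X\<^sub>1]\<close>, whose negative half is the exponent in the limit of the characters.\<close>

lemma inner_increment_second_moment:
  "(\<Sum>u\<in>B. increment_pmf N X u * (s \<bullet> real_vec u)\<^sup>2) = s \<bullet> (increment_second_moment N X *v s)"
proof -
  have lin: "linear (\<lambda>A :: real ^ 'd ^ 'd. s \<bullet> (A *v s))"
    by (rule linearI) (simp_all add: matrix_vector_mult_add_rdistrib inner_add_right flip: scaleR_matrix_vector_assoc)
  have outer: "s \<bullet> (outer_product x x *v s) = (s \<bullet> x)\<^sup>2" for x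
  proof -
    have "outer_product x x *v s = (s \<bullet> x) *\<^sub>R x"
      by (simp add: vec_eq_iff outer_product_def matrix_vector_mult_def inner_vec_def sum_distrib_left mult_ac)
    then show ?thesis by (simp add: power2_eq_square)
  qed
  show ?thesis
    unfolding increment_second_moment_def integral_increment[of "\<lambda>u. outer_product (real_vec u) (real_vec u)"]
    by (simp add: linear_sum[OF lin] linear_scale[OF lin] outer)
qed

end

lemma finite_step_urn_of_walk:
  assumes walk: "bounded_increment_walk N X B" and urn: "infinite_color_urn M (increment_pmf N X) u0 Z U"
  shows "finite_step_urn M (increment_pmf N X) u0 Z U B"
proof -
  interpret walk: bounded_increment_walk N X B by fact
  interpret urn: infinite_color_urn M "increment_pmf N X" u0 Z U by fact
  show ?thesis
  proof
    show "(\<Sum>u\<in>B. increment_pmf N X u) = 1"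
      using walk.integral_increment[of "\<lambda>_. 1::real"] by (simp add: walk.prob_space)
  qed (use walk.B walk.supp in \<open>auto simp: increment_pmf_def\<close>)
qed

theorem theorem4:
  fixes N :: "'b measure" and X :: "nat \<Rightarrow> 'b \<Rightarrow> int ^ 'd::finite" and B :: "(int ^ 'd) set"
    and M :: "'a measure" and u0 :: "int ^ 'd \<Rightarrow> real"
    and Z :: "nat \<Rightarrow> 'a \<Rightarrow> int ^ 'd" and U :: "nat \<Rightarrow> 'a \<Rightarrow> int ^ 'd \<Rightarrow> real"
  assumes walk: "bounded_increment_walk N X B"
    and pos_def: "positive_definite (increment_second_moment N X)"
    and urn: "infinite_color_urn M (increment_pmf N X) u0 Z U"
  shows "converges_in_prob M weak_topology
    (scaled_urn_measure (increment_mean N X) (matrix_sqrt (increment_second_moment N X)) U)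
    std_gaussian"
proof -
  define m A where "m = increment_mean N X" and "A = increment_second_moment N X"
  define S where "S = matrix_sqrt A"
  define q where "q t = matrix_inv S *v t" for t
  interpret walk: bounded_increment_walk N X B by fact
  interpret finite_step_urn M "increment_pmf N X" u0 Z U B by (rule finite_step_urn_of_walk[OF walk urn])
  have S: "positive_definite S" "S ** S = A"
    using matrix_sqrt[OF pos_def] by (simp_all add: S_def A_def)
  have inv: "invertible S" by (rule positive_definite_invertible[OF S(1)])
  have m: "m = step_mean"
    unfolding m_def increment_mean_def step_mean_def by (rule walk.integral_increment)
  have var: "(\<Sum>u\<in>B. increment_pmf N X u * (q t \<bullet> real_vec u)\<^sup>2) = t \<bullet> t" for t
  proof -
    have "S *v q t = t" using invertible_matrix_inv(1)[OF inv] by (simp add: q_def matrix_vector_mul_assoc)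
    moreover have "q t \<bullet> (A *v q t) = (S *v q t) \<bullet> (S *v q t)"
      unfolding S(2)[symmetric] matrix_vector_mul_assoc[symmetric] positive_definite_inner(2)[OF S(1)] ..
    ultimately show ?thesis unfolding walk.inner_increment_second_moment A_def[symmetric] by simp
  qed
  let ?L = "scaled_urn_measure m S U"
  have "converges_in_prob M weak_topology ?L std_gaussian"
  proof (rule characters_and_moments_imp_convergence[where ?n0.0 = 2])
    show "prob_space M" by (rule prob_space_axioms)
    show "?L n \<omega> \<in> prob_measures" if "n \<ge> 2" "\<omega> \<in> space M" for n \<omega>
      by (rule scaled_urn_measure_prob[OF inv that])
    show "std_gaussian \<in> prob_measures" by (rule std_gaussian_prob_measures)
    show "(\<lambda>\<omega>. \<integral>x. f x \<partial>?L n \<omega>) \<in> borel_measurable M"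
      if "n \<ge> 2" "continuous_on UNIV f" "bounded (range f)" for n and f :: "real ^ 'd \<Rightarrow> complex"
    proof -
      have "(\<lambda>\<omega>. tally n (\<lambda>v. f (standardize m S n (real_vec v))) \<omega> /\<^sub>R (real n + 1)) \<in> borel_measurable M"
        by measurable
      then show ?thesis
        by (rule measurable_cong[THEN iffD1, rotated])
          (simp add: integral_scaled_urn_measure(2)[OF inv that(1) _ borel_measurable_continuous_onI[OF that(2)]])
    qed
  next
    fix t :: "real ^ 'd"
    define \<theta> where "\<theta> n = q t /\<^sub>R sqrt (ln (real n))" for n :: nat
    define ch where "ch n v = cis (\<theta> n \<bullet> real_vec v)" for n v
    define G where "G = complex_of_real (exp (- (t \<bullet> t) / 2))"
    let ?c = "\<lambda>n. cis (- (ln (real n) * (\<theta> n \<bullet> step_mean)))"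
    have "(\<lambda>n. ?c n * mean_average n (ch n)) \<longlonglongrightarrow> G"
      unfolding G_def ch_def \<theta>_def using mean_character_limit[of "q t"] by (simp only: var)
    then have "(\<lambda>n. norm (?c n * mean_average n (ch n) - G)) \<longlonglongrightarrow> 0"
      by (simp add: LIM_zero_iff tendsto_norm_zero_iff)
    moreover have "(\<lambda>n. \<integral>\<omega>. norm (tally n (ch n) \<omega> /\<^sub>R (real n + 1) - mean_average n (ch n)) \<partial>M) \<longlonglongrightarrow> 0"
      unfolding ch_def \<theta>_def by (rule character_deviation_limit)
    \<comment> \<open>the error splits into the deviation from the mean and the error of the mean\<close>
    ultimately have up: "(\<lambda>n. (\<integral>\<omega>. norm (tally n (ch n) \<omega> /\<^sub>R (real n + 1) - mean_average n (ch n)) \<partial>M)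
        + norm (?c n * mean_average n (ch n) - G)) \<longlonglongrightarrow> 0"
      using tendsto_add by fastforce
    have cis_m: "(\<lambda>x. cis (t \<bullet> x)) \<in> borel_measurable borel" by measurable
    have eq: "(\<integral>x. cis (t \<bullet> x) \<partial>?L n \<omega>) = ?c n * (tally n (ch n) \<omega> /\<^sub>R (real n + 1))"
      if "n \<ge> 2" "\<omega> \<in> space M" for n \<omega>
    proof -
      have "cis (t \<bullet> standardize m S n (real_vec v)) = ?c n * ch n v" for v
        by (simp add: inner_standardize ch_def \<theta>_def q_def m inner_diff_right cis_mult)
      then show ?thesis
        by (simp add: integral_scaled_urn_measure(2)[OF inv that cis_m] tally_mult)
    qed
    show "(\<lambda>n. \<integral>\<omega>. norm ((\<integral>x. cis (t \<bullet> x) \<partial>?L n \<omega>) - (\<integral>x. cis (t \<bullet> x) \<partial>std_gaussian)) \<partial>M) \<longlonglongrightarrow> 0"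
      unfolding std_gaussian_char G_def[symmetric]
    proof (rule tendsto_sandwich[OF _ _ tendsto_const up])
      show "\<forall>\<^sub>F n in sequentially. (\<integral>\<omega>. norm ((\<integral>x. cis (t \<bullet> x) \<partial>?L n \<omega>) - G) \<partial>M)
        \<le> (\<integral>\<omega>. norm (tally n (ch n) \<omega> /\<^sub>R (real n + 1) - mean_average n (ch n)) \<partial>M)
          + norm (?c n * mean_average n (ch n) - G)"
        using eventually_ge_at_top[of 2]
      proof eventually_elim
        case (elim n)
        let ?Y = "\<lambda>\<omega>. tally n (ch n) \<omega> /\<^sub>R (real n + 1)"
        have "(\<integral>\<omega>. norm ((\<integral>x. cis (t \<bullet> x) \<partial>?L n \<omega>) - G) \<partial>M) = (\<integral>\<omega>. norm (?c n * ?Y \<omega> - G) \<partial>M)"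
          by (intro Bochner_Integration.integral_cong refl) (simp only: eq[OF elim])
        also have "\<dots> \<le> (\<integral>\<omega>. norm (?Y \<omega> - mean_average n (ch n)) + norm (?c n * mean_average n (ch n) - G) \<partial>M)"
        proof (rule integral_mono)
          fix \<omega>
          have "norm (?c n * ?Y \<omega> - G) \<le> norm (?c n * (?Y \<omega> - mean_average n (ch n))) + norm (?c n * mean_average n (ch n) - G)"
            by (rule order_trans[OF eq_refl norm_triangle_ineq]) (simp add: algebra_simps)
          then show "norm (?c n * ?Y \<omega> - G) \<le> norm (?Y \<omega> - mean_average n (ch n)) + norm (?c n * mean_average n (ch n) - G)"
            by (simp add: norm_mult)
        qed auto
        also have "\<dots> = (\<integral>\<omega>. norm (?Y \<omega> - mean_average n (ch n)) \<partial>M) + norm (?c n * mean_average n (ch n) - G)"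
          by (simp add: prob_space)
        finally show ?case .
      qed
    qed (auto intro!: always_eventually)
  next
    have sq_m: "(\<lambda>x :: real ^ 'd. (x $ i)\<^sup>2) \<in> borel_measurable borel" for i by measurable
    show "integrable (?L n \<omega>) (\<lambda>x. (x $ i)\<^sup>2)" if "n \<ge> 2" "\<omega> \<in> space M" for n \<omega> i
      by (rule integral_scaled_urn_measure(1)[OF inv that sq_m])
    have eq: "(\<integral>x. (x $ i)\<^sup>2 \<partial>?L n \<omega>)
        = tally n (\<lambda>v. ((q (axis i 1) /\<^sub>R sqrt (ln (real n))) \<bullet> (real_vec v - ln (real n) *\<^sub>R step_mean))\<^sup>2) \<omega> /\<^sub>R (real n + 1)"
      if "n \<ge> 2" "\<omega> \<in> space M" for n \<omega> i
    proof -
      have "standardize m S n y $ i = (q (axis i 1) /\<^sub>R sqrt (ln (real n))) \<bullet> (y - ln (real n) *\<^sub>R step_mean)" for y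
        unfolding q_def m[symmetric] inner_standardize[symmetric] by (simp add: inner_axis')
      then show ?thesis by (simp add: integral_scaled_urn_measure(2)[OF inv that sq_m])
    qed
    show "integrable M (\<lambda>\<omega>. \<integral>x. (x $ i)\<^sup>2 \<partial>?L n \<omega>)" if "n \<ge> 2" for n i
      by (subst Bochner_Integration.integrable_cong[OF refl eq[OF that]]) auto
    show "\<exists>C. \<forall>n\<ge>2. (\<integral>\<omega>. \<integral>x. (x $ i)\<^sup>2 \<partial>?L n \<omega> \<partial>M) \<le> C" for i
    proof -
      have "(\<integral>\<omega>. \<integral>x. (x $ i)\<^sup>2 \<partial>?L n \<omega> \<partial>M)
        = mean_average n (\<lambda>v. ((q (axis i 1) /\<^sub>R sqrt (ln (real n))) \<bullet> (real_vec v - ln (real n) *\<^sub>R step_mean))\<^sup>2)"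
        if "n \<ge> 2" for n
        by (subst Bochner_Integration.integral_cong[OF refl eq[OF that]]) (auto simp: mean_average_def)
      then show ?thesis using second_moment_bounded[of "q (axis i 1)"] by simp
    qed
  qed
  then show ?thesis by (simp add: m_def S_def A_def)
qed

end
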